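(* Let $a\in\mathbb R$, and let $(U^-,U^+)$ be a slow parallel MHD shock of the two-dimensional ideal isothermal MHD equations with pressure law $p=\rho$, with magnetic field component $b_1=a$ normal to the shock front, and with $\rho^-=1$. Let $\Delta$ be its Lopatinski determinant. If $$\rho^+=\frac{a^2+2}{a^2+1},$$ then $\Delta(0,1)=0$ and $\Delta(0,-1)=0$.
   Context: **Equations.** Two-dimensional ideal isothermal MHD with pressure $p=\rho$ (sound speed $1$) is $U_t+F(U)_x+G(U)_y=0$ together with $\operatorname{div}B=0$. Here $V=(v_1,v_2)$ is the velocity, $B=(b_1,b_2)$ is the magnetic field, $\rho>0$ is the density, $U=(\rho,\rho v_1,\rho v_2,b_1,b_2)^\top$, and $$F(U)=\begin{pmatrix}\rho v_1\\ \rho v_1^2+\rho+\frac12(b_2^2-b_1^2)\\ \rho v_1v_2-b_1b_2\\ 0\\ b_2v_1-v_2b_1\end{pmatrix},\qquad G(U)=\begin{pmatrix}\rho v_2\\ \rho v_2v_1-b_2b_1\\ \rho v_2^2+\rho+\frac12(b_1^2-b_2^2)\\ b_1v_2-v_1b_2\\ 0\end{pmatrix}.$$ **Quasilinear form.** Using $\operatorname{div}B=0$, the system is also written as $U_t+\mathbf A(U)U_x+\mathbf B(U)U_y=0$ with $\mathbf A=\mathbf T\mathbf D^{-1}\tilde{\mathbf A}\mathbf T^{-1}$ and $\mathbf B=\mathbf T\mathbf D^{-1}\tilde{\mathbf B}\mathbf T^{-1}$, where $\mathbf D=\operatorname{diag}(1/\rho,\rho,\rho,1,1)$, $$\mathbf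 T=\begin{pmatrix}1&0&0&0&0\\ v_1&\rho&0&0&0\\ v_2&0&\rho&0&0\\ 0&0&0&1&0\\ 0&0&0&0&1\end{pmatrix},$$ $$\tilde{\mathbf A}=\begin{pmatrix} v_1/\rho&1&0&0&0\\ 1&\rho v_1&0&0&b_2\\ 0&0&\rho v_1&0&-b_1\\ 0&0&0&v_1&0\\ 0&b_2&-b_1&0&v_1\end{pmatrix},\qquad \tilde{\mathbf B}=\begin{pmatrix} v_2/\rho&0&1&0&0\\ 0&\rho v_2&0&-b_2&0\\ 1&0&\rho v_2&b_1&0\\ 0&-b_2&b_1&v_2&0\\ 0&0&0&0&v_2\end{pmatrix}.$$ (These $\mathbf A,\mathbf B$ are not the Jacobians of $F,G$.) **Shocks.** A planar shock (normalized to be stationary with front $\{x=0\}$) is a pair of states $U^\pm=(\rho^\pm,\rho^\pm v^\pm,\rho^\pm w^\pm,a,b^\pm)^\top$, where $v,w,b$ stand for $v_1,v_2,b_2$, satisfying the Rankine–Hugoniot conditions $F(U^-)=F(U^+)$. Equivalently, both states satisfy $$\rho v=m,\qquad \rho v^2+\rho+\tfrac12b^2=j,\qquad vb-aw=c,\qquad mw-ab=d$$ for common constants $m,j,c,d\in\mathbb R$. Without loss of generality one normalizes $m>0$ and $d=0$. The shock is *parallel* if $c=0$. It is a *slow* (Lax) shock if $0<\rho^+(v^+)^2<\rho^-(v^-)^2<a^2$. With these normalizations and $\rho^-=1$, a slow parallel shock has $w^\pm=b^\pm=0$, $v^-=\sqrt{\rho^+}$, $v^+=1/\sqrt{\rho^+}$,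 so that $$U^-=(1,\sqrt{\rho^+},0,a,0)^\top,\qquad U^+=(\rho^+,\sqrt{\rho^+},0,a,0)^\top,$$ and the slow Lax condition reads $1<\rho^+<a^2$. **Lopatinski determinant.** Write $\mathbb C_+=\{\lambda\in\mathbb C:\Re\lambda>0\}$, $\mathbf A^\pm=\mathbf A(U^\pm)$, $\mathbf B^\pm=\mathbf B(U^\pm)$, and for $(\lambda,\omega)\in(\overline{\mathbb C_+}\times\mathbb R)\setminus\{(0,0)\}$ set $$\mathbf L^\pm(\lambda,\omega)=(\lambda\mathbf I+i\omega\mathbf B^\pm)(\mathbf A^\pm)^{-1},\qquad J(\lambda,\omega)=\lambda(U^+-U^-)+i\omega\,(G(U^+)-G(U^-)).$$ For $(\lambda,\omega)\in\mathbb C_+\times\mathbb R$, the matrices $\mathbf L^\pm$ have no purely imaginary eigenvalues. There, $R^-(\lambda,\omega)$ is a matrix whose columns form a basis of the stable space of $\mathbf L^-$ (the sum of generalized eigenspaces for eigenvalues with negative real part), and $R^+(\lambda,\omega)$ is a matrix whose columns form a basis of the unstable space of $\mathbf L^+$ (eigenvalues with positive real part). For slow shocks these spaces have constant dimensions $1$ and $3$, respectively. At points with $\Re\lambda=0$, $(\lambda,\omega)\ne(0,0)$, $R^\pm(\lambda,\omega)$ are bases of the limits of these spaces as the point is approached from $\mathbb C_+\times\mathbb R$. The Lopatinski determinant is the $5\times5$ determinant $$\Delta(\lambda,\omega)=\det\big(R^-(\lambda,\omega),\,J(\lambda,\omega),\,R^+(\lambda,\omega)\big).$$ It depends on the choice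 of bases only through a nonzero factor, so its vanishing at a given point is independent of this choice. *)

theory Defs
  imports "HOL-Analysis.Analysis"
begin

section \<open>Two-dimensional isothermal MHD with pressure law \<open>p = \<rho>\<close>\<close>

text \<open>A state is the vector \<open>(\<rho>, \<rho> v1, \<rho> v2, b1, b2)\<close> of conserved variables. In the index type
  \<open>5\<close> the numeral \<open>5\<close> denotes the same element as \<open>0\<close>; \<open>vector\<close> fills the positions \<open>1, ..., 5\<close>
  in this order.\<close>

type_synonym state = "real ^ 5"

definition rho :: "state \<Rightarrow> real" where "rho U = U $ 1"
definition vel1 :: "state \<Rightarrow> real" where "vel1 U = U $ 2 / U $ 1"
definition vel2 :: "state \<Rightarrow> real" where "vel2 U = U $ 3 / U $ 1"
definition mag1 :: "state \<Rightarrow> real" where "mag1 U = U $ 4"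
definition mag2 :: "state \<Rightarrow> real" where "mag2 U = U $ 5"

definition flux_F :: "state \<Rightarrow> real ^ 5" where
  "flux_F U = (let \<rho> = rho U; v1 = vel1 U; v2 = vel2 U; b1 = mag1 U; b2 = mag2 U in
     vector [\<rho> * v1,
             \<rho> * v1\<^sup>2 + \<rho> + (b2\<^sup>2 - b1\<^sup>2) / 2,
             \<rho> * v1 * v2 - b1 * b2,
             0,
             b2 * v1 - v2 * b1])"

definition flux_G :: "state \<Rightarrow> real ^ 5" where
  "flux_G U = (let \<rho> = rho U; v1 = vel1 U; v2 = vel2 U; b1 = mag1 U; b2 = mag2 U in
     vector [\<rho> * v2,
             \<rho> * v2 * v1 - b2 * b1,
             \<rho> * v2\<^sup>2 + \<rho> + (b1\<^sup>2 - b2\<^sup>2) / 2,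
             b1 * v2 - v1 * b2,
             0])"

subsection \<open>Quasilinear form\<close>

definition mat_D :: "state \<Rightarrow> real ^ 5 ^ 5" where
  "mat_D U = (let \<rho> = rho U in
     vector [vector [1 / \<rho>, 0, 0, 0, 0],
             vector [0, \<rho>, 0, 0, 0],
             vector [0, 0, \<rho>, 0, 0],
             vector [0, 0, 0, 1, 0],
             vector [0, 0, 0, 0, 1]])"

definition mat_T :: "state \<Rightarrow> real ^ 5 ^ 5" where
  "mat_T U = (let \<rho> = rho U; v1 = vel1 U; v2 = vel2 U in
     vector [vector [1, 0, 0, 0, 0],
             vector [v1, \<rho>, 0, 0, 0],
             vector [v2, 0, \<rho>, 0, 0],
             vector [0, 0, 0, 1, 0],
             vector [0, 0, 0, 0, 1]])"

definition mat_A_sym :: "state \<Rightarrow> real ^ 5 ^ 5" where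
  "mat_A_sym U = (let \<rho> = rho U; v1 = vel1 U; b1 = mag1 U; b2 = mag2 U in
     vector [vector [v1 / \<rho>, 1, 0, 0, 0],
             vector [1, \<rho> * v1, 0, 0, b2],
             vector [0, 0, \<rho> * v1, 0, - b1],
             vector [0, 0, 0, v1, 0],
             vector [0, b2, - b1, 0, v1]])"

definition mat_B_sym :: "state \<Rightarrow> real ^ 5 ^ 5" where
  "mat_B_sym U = (let \<rho> = rho U; v2 = vel2 U; b1 = mag1 U; b2 = mag2 U in
     vector [vector [v2 / \<rho>, 0, 1, 0, 0],
             vector [0, \<rho> * v2, 0, - b2, 0],
             vector [1, 0, \<rho> * v2, b1, 0],
             vector [0, - b2, b1, v2, 0],
             vector [0, 0, 0, 0, v2]])"

definition mat_A :: "state \<Rightarrow> real ^ 5 ^ 5" where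
  "mat_A U = mat_T U ** matrix_inv (mat_D U) ** mat_A_sym U ** matrix_inv (mat_T U)"

definition mat_B :: "state \<Rightarrow> real ^ 5 ^ 5" where
  "mat_B U = mat_T U ** matrix_inv (mat_D U) ** mat_B_sym U ** matrix_inv (mat_T U)"

section \<open>Slow parallel shocks\<close>

text \<open>Stationary planar shocks with front \<open>{x = 0}\<close>. The equality of the normal magnetic field
  is a separate requirement, because the fourth component of \<^const>\<open>flux_F\<close> vanishes.\<close>

definition planar_shock :: "real \<Rightarrow> state \<Rightarrow> state \<Rightarrow> bool" where
  "planar_shock a Um Up \<longleftrightarrow>
     rho Um > 0 \<and> rho Up > 0 \<and> mag1 Um = a \<and> mag1 Up = a \<and> flux_F Um = flux_F Up"

text \<open>The constants \<open>m\<close>, \<open>c\<close>, \<open>d\<close> below are common to both states of a planar shock, so they are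
  evaluated at the left state.\<close>

definition shock_m :: "state \<Rightarrow> real" where
  "shock_m U = rho U * vel1 U"

definition shock_c :: "state \<Rightarrow> real" where
  "shock_c U = vel1 U * mag2 U - mag1 U * vel2 U"

definition shock_d :: "state \<Rightarrow> real" where
  "shock_d U = shock_m U * vel2 U - mag1 U * mag2 U"

definition normalized_shock :: "real \<Rightarrow> state \<Rightarrow> state \<Rightarrow> bool" where
  "normalized_shock a Um Up \<longleftrightarrow> planar_shock a Um Up \<and> shock_m Um > 0 \<and> shock_d Um = 0"

definition slow_parallel_shock :: "real \<Rightarrow> state \<Rightarrow> state \<Rightarrow> bool" where
  "slow_parallel_shock a Um Up \<longleftrightarrow>
     normalized_shock a Um Up \<and>
     shock_c Um = 0 \<and>
     0 < rho Up * (vel1 Up)\<^sup>2 \<and>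
     rho Up * (vel1 Up)\<^sup>2 < rho Um * (vel1 Um)\<^sup>2 \<and>
     rho Um * (vel1 Um)\<^sup>2 < a\<^sup>2"

section \<open>Stable and unstable spaces\<close>

definition eigenvalue :: "complex ^ 'm ^ 'm \<Rightarrow> complex \<Rightarrow> bool" where
  "eigenvalue M \<mu> \<longleftrightarrow> (\<exists>x. x \<noteq> 0 \<and> M *v x = \<mu> *s x)"

definition generalized_eigenspace :: "complex ^ 'm ^ 'm \<Rightarrow> complex \<Rightarrow> (complex ^ 'm) set" where
  "generalized_eigenspace M \<mu> = {x. \<exists>k::nat. ((\<lambda>y. (M - mat \<mu>) *v y) ^^ k) x = 0}"

definition stable_space :: "complex ^ 'm ^ 'm \<Rightarrow> (complex ^ 'm) set" where
  "stable_space M =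
     vec.span (\<Union>\<mu> \<in> {\<mu>. eigenvalue M \<mu> \<and> Re \<mu> < 0}. generalized_eigenspace M \<mu>)"

definition unstable_space :: "complex ^ 'm ^ 'm \<Rightarrow> (complex ^ 'm) set" where
  "unstable_space M =
     vec.span (\<Union>\<mu> \<in> {\<mu>. eigenvalue M \<mu> \<and> Re \<mu> > 0}. generalized_eigenspace M \<mu>)"

definition indexed_basis :: "'i set \<Rightarrow> ('i \<Rightarrow> complex ^ 'm) \<Rightarrow> (complex ^ 'm) set \<Rightarrow> bool" where
  "indexed_basis I b E \<longleftrightarrow> inj_on b I \<and> vec.independent (b ` I) \<and> vec.span (b ` I) = E"

definition column_basis :: "complex ^ 'n ^ 'm \<Rightarrow> (complex ^ 'm) set \<Rightarrow> bool" where
  "column_basis R E \<longleftrightarrow> indexed_basis UNIV (\<lambda>j. column j R) E"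

text \<open>Convergence of subspaces of \<open>\<complex>\<^sup>m\<close> in the Grassmannian: for a nontrivial filter, the spaces
  \<open>E p\<close> converge to \<open>E0\<close> iff some bases of \<open>E p\<close> converge, vector by vector, to a basis of \<open>E0\<close>.\<close>

definition subspace_tendsto ::
  "('p \<Rightarrow> (complex ^ 'm) set) \<Rightarrow> (complex ^ 'm) set \<Rightarrow> 'p filter \<Rightarrow> bool" where
  "subspace_tendsto E E0 F \<longleftrightarrow>
     (\<exists>(n::nat) b b0.
        (\<forall>\<^sub>F p in F. indexed_basis {..<n} (b p) (E p)) \<and>
        indexed_basis {..<n} b0 E0 \<and>
        (\<forall>i<n. ((\<lambda>p. b p i) \<longlongrightarrow> b0 i) F))"

section \<open>The Lopatinski determinant\<close>

definition cvec :: "real ^ 'm \<Rightarrow> complex ^ 'm" where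
  "cvec x = (\<chi> i. complex_of_real (x $ i))"

definition mat_L :: "state \<Rightarrow> complex \<Rightarrow> real \<Rightarrow> complex ^ 5 ^ 5" where
  "mat_L U lam om =
     (mat lam + map_matrix (\<lambda>z. \<i> * complex_of_real om * complex_of_real z) (mat_B U)) **
     matrix_inv (map_matrix complex_of_real (mat_A U))"

definition jump_J :: "state \<Rightarrow> state \<Rightarrow> complex \<Rightarrow> real \<Rightarrow> complex ^ 5" where
  "jump_J Um Up lam om =
     lam *s cvec (Up - Um) + (\<i> * complex_of_real om) *s cvec (flux_G Up - flux_G Um)"

text \<open>Bases at interior points (\<open>Re lam > 0\<close>) and, by passing to the limit of the spaces from
  the interior, at boundary points (\<open>Re lam = 0\<close>, \<open>(lam, om) \<noteq> (0, 0)\<close>).\<close>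

definition interior_freq :: "(complex \<times> real) set" where
  "interior_freq = {lam. Re lam > 0} \<times> UNIV"

definition boundary_freq :: "(complex \<times> real) set" where
  "boundary_freq = ({lam. Re lam = 0} \<times> UNIV) - {(0, 0)}"

definition extended_basis ::
  "(complex \<times> real \<Rightarrow> (complex ^ 5) set) \<Rightarrow> complex \<times> real \<Rightarrow> complex ^ 'n ^ 5 \<Rightarrow> bool" where
  "extended_basis E p R \<longleftrightarrow>
     (p \<in> interior_freq \<and> column_basis R (E p)) \<or>
     (p \<in> boundary_freq \<and>
       (\<exists>E0. subspace_tendsto E E0 (at p within interior_freq) \<and> column_basis R E0))"

definition minus_basis :: "state \<Rightarrow> complex \<Rightarrow> real \<Rightarrow> complex ^ 1 ^ 5 \<Rightarrow> bool" where
  "minus_basis Um lam om Rm \<longleftrightarrow>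
     extended_basis (\<lambda>(lam', om'). stable_space (mat_L Um lam' om')) (lam, om) Rm"

definition plus_basis :: "state \<Rightarrow> complex \<Rightarrow> real \<Rightarrow> complex ^ 3 ^ 5 \<Rightarrow> bool" where
  "plus_basis Up lam om Rp \<longleftrightarrow>
     extended_basis (\<lambda>(lam', om'). unstable_space (mat_L Up lam' om')) (lam, om) Rp"

definition lopatinski_det ::
  "complex ^ 1 ^ 5 \<Rightarrow> complex ^ 5 \<Rightarrow> complex ^ 3 ^ 5 \<Rightarrow> complex" where
  "lopatinski_det Rm J Rp =
     det (transpose (vector [column 1 Rm, J, column 1 Rp, column 2 Rp, column 3 Rp])
          :: complex ^ 5 ^ 5)"

text \<open>The set of all values of \<open>\<Delta>(lam, om)\<close>, over all admissible choices of bases. Thus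
  \<open>\<Delta>(lam, om) = 0\<close> means that this set is \<open>{0}\<close>: admissible bases exist (in particular the limit spaces exist
  at a boundary point and have dimensions 1 and 3), and the determinant vanishes for every choice.\<close>

definition lopatinski_values :: "state \<Rightarrow> state \<Rightarrow> complex \<Rightarrow> real \<Rightarrow> complex set" where
  "lopatinski_values Um Up lam om =
     {lopatinski_det Rm (jump_J Um Up lam om) Rp | Rm Rp.
        minus_basis Um lam om Rm \<and> plus_basis Up lam om Rp}"

end

theory Submission
  imports Defs "HOL-Computational_Algebra.Fundamental_Theorem_Algebra"
begin

text \<open>
  In the coordinates \<open>x = T D\<^sup>-\<^sup>1 A\<^sub>s y\<close>, where \<open>A\<^sub>s, B\<^sub>s\<close> are the symmetric matrices of the quasilinear
  form, the eigenvalue problem \<open>L x = \<mu> x\<close> becomes the symmetric pencil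
  \<open>(\<lambda> D + i \<omega> B\<^sub>s) y = \<mu> A\<^sub>s y\<close>. Pairing it with \<open>y\<close> gives
  \<open>Re \<lambda> \<langle>D y, y\<rangle> = Re \<mu> \<langle>A\<^sub>s y, y\<rangle>\<close>, so for \<open>Re \<lambda> > 0\<close> the sign of \<open>\<langle>A\<^sub>s y, y\<rangle>\<close> decides whether \<open>\<mu>\<close> is
  stable. As \<open>\<lambda> \<rightarrow> 0\<close> three eigenvalues tend to \<open>0\<close>, and \<open>A\<^sub>s\<close> is positive definite on the
  three-dimensional limit eigenspace, the kernel of \<open>L(0, \<omega>)\<close>; hence these three are unstable. The two
  remaining eigenvalues tend to \<open>\<plusminus> r \<noteq> 0\<close>. In front of the shock \<open>r\<close> is real, so
  the stable space converges to the eigenline of \<open>- r\<close>. Behind the shock \<open>r\<close> is imaginary, and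
  \<open>\<langle>A\<^sub>s y, y\<rangle> < 0\<close> on both limit eigenvectors, so the unstable space converges to the kernel. The linear
  functional \<open>y\<^sub>1 + a y\<^sub>4\<close> of the state behind the shock vanishes on this kernel and on the jump vector, and
  for the given value of \<open>\<rho>\<^sup>+\<close> also on the limit stable eigenvector, which makes the determinant vanish.
\<close>

section \<open>Invariant subspaces and the unstable space\<close>

lemma mat_mult_vec: "(mat z :: complex ^ 'n ^ 'n) *v x = z *s x"
  by (simp add: vec_eq_iff mat_def matrix_vector_mult_def if_distrib[of "\<lambda>u. u * _"] cong: if_cong)

lemma shift_mult_vec: "((M :: complex ^ 'n ^ 'n) - mat z) *v x = M *v x - z *s x"
  by (simp add: matrix_vector_mult_diff_rdistrib mat_mult_vec)

lemma shift_in_subspace: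
  fixes M :: "complex ^ 'n ^ 'n"
  assumes "vec.subspace W" "\<And>x. x \<in> W \<Longrightarrow> M *v x \<in> W" "x \<in> W"
  shows "(M - mat z) *v x \<in> W"
  using assms by (simp add: shift_mult_vec vec.subspace_diff vec.subspace_scale)

lemma funpow_shift_zero: "(((\<lambda>y. ((M :: complex ^ 'n ^ 'n) - mat z) *v y) ^^ k) 0) = 0"
  by (induction k) (auto simp: shift_mult_vec)

lemma funpow_shift_add:
  "((\<lambda>y. ((M :: complex ^ 'n ^ 'n) - mat z) *v y) ^^ k) (x + y) =
     ((\<lambda>y. (M - mat z) *v y) ^^ k) x + ((\<lambda>y. (M - mat z) *v y) ^^ k) y"
  by (induction k) (auto simp: matrix_vector_right_distrib)

lemma funpow_shift_scale:
  "((\<lambda>y. ((M :: complex ^ 'n ^ 'n) - mat z) *v y) ^^ k) (c *s x) =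
     c *s ((\<lambda>y. (M - mat z) *v y) ^^ k) x"
  by (induction k) (auto simp: vec.scale)

lemma generalized_eigenspace_subspace:
  "vec.subspace (generalized_eigenspace (M :: complex ^ 'n ^ 'n) \<mu>)"
proof -
  let ?N = "\<lambda>y. (M - mat \<mu>) *v y"
  have mono: "(?N ^^ (k + l)) x = 0" if "(?N ^^ k) x = 0" for k l x
    using that by (subst add.commute) (simp add: funpow_add funpow_shift_zero)
  show ?thesis
    unfolding vec.subspace_def generalized_eigenspace_def
  proof (safe, goal_cases)
    case 1
    show ?case by (rule exI[of _ 0]) simp
  next
    case (2 x y k l)
    show ?case
      using mono[OF 2(1), of l] mono[OF 2(2), of k]
      by (intro exI[of _ "k + l"]) (simp add: funpow_shift_add add.commute)
  next
    case (3 c x k)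
    then show ?case by (intro exI[of _ k]) (simp add: funpow_shift_scale)
  qed
qed

text \<open>The last nonzero vector in the chain of iterates of \<open>M - mat \<mu>\<close> started
  at \<open>x\<close> is an eigenvector, and the chain never leaves \<open>W\<close>.\<close>

lemma eigenvector_in_invariant_subspace:
  fixes M :: "complex ^ 'n ^ 'n"
  assumes W: "vec.subspace W" "\<And>x. x \<in> W \<Longrightarrow> M *v x \<in> W"
    and x: "x \<in> W" "x \<noteq> 0" "x \<in> generalized_eigenspace M \<mu>"
  obtains y where "y \<in> W" "y \<noteq> 0" "M *v y = \<mu> *s y"
proof -
  have "\<exists>y\<in>W. y \<noteq> 0 \<and> M *v y = \<mu> *s y"
    if "x \<in> W" "x \<noteq> 0" "((\<lambda>y. (M - mat \<mu>) *v y) ^^ k) x = 0" for k and x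
    using that
  proof (induction k arbitrary: x)
    case (Suc k)
    show ?case
    proof (cases "(M - mat \<mu>) *v x = 0")
      case True
      then show ?thesis using Suc.prems by (auto simp: shift_mult_vec)
    next
      case False
      then show ?thesis
        using Suc.IH[of "(M - mat \<mu>) *v x"] Suc.prems shift_in_subspace[OF W, of x]
        by (simp add: funpow_Suc_right del: funpow.simps)
    qed
  qed simp
  then show ?thesis using x that unfolding generalized_eigenspace_def by blast
qed

text \<open>Neumann series of \<open>M - z = (\<mu> - z) + (M - \<mu>)\<close>, which is finite because \<open>M - \<mu>\<close> is nilpotent here.\<close>

lemma shift_surj_on_generalized_eigenspace:
  fixes M :: "complex ^ 'n ^ 'n"
  assumes W: "vec.subspace W" "\<And>x. x \<in> W \<Longrightarrow> M *v x \<in> W"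
    and g: "g \<in> W" "g \<in> generalized_eigenspace M \<mu>" and "z \<noteq> \<mu>"
  obtains h where "h \<in> W" "h \<in> generalized_eigenspace M \<mu>" "(M - mat z) *v h = g"
proof -
  let ?G = "generalized_eigenspace M \<mu>"
  have "\<exists>h\<in>W \<inter> ?G. (M - mat z) *v h = g"
    if "g \<in> W" "((\<lambda>y. (M - mat \<mu>) *v y) ^^ k) g = 0" for k g
    using that
  proof (induction k arbitrary: g)
    case 0
    then show ?case
      using W(1) by (intro bexI[of _ 0])
        (auto simp: vec.subspace_0 generalized_eigenspace_subspace)
  next
    case (Suc k)
    define c where "c = \<mu> - z"
    have "c \<noteq> 0" using \<open>z \<noteq> \<mu>\<close> by (simp add: c_def)
    have "((\<lambda>y. (M - mat \<mu>) *v y) ^^ k) ((M - mat \<mu>) *v g) = 0"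
      using Suc.prems(2) by (simp add: funpow_Suc_right del: funpow.simps)
    then obtain h where h: "h \<in> W" "h \<in> ?G" "(M - mat z) *v h = (M - mat \<mu>) *v g"
      using Suc.IH[of "(M - mat \<mu>) *v g"] shift_in_subspace[OF W Suc.prems(1)] by auto
    have "g \<in> ?G" using Suc.prems(2) unfolding generalized_eigenspace_def by blast
    have "(M - mat z) *v (inverse c *s (g - h)) = inverse c *s ((M - mat z) *v g - (M - mat \<mu>) *v g)"
      using h(3) by (simp add: vec.scale matrix_vector_mult_diff_distrib)
    also have "\<dots> = inverse c *s (c *s g)"
      by (simp add: shift_mult_vec c_def vec.scale_left_diff_distrib)
    also have "\<dots> = g" using \<open>c \<noteq> 0\<close> by (simp add: vector_smult_assoc)
    finally show ?case
      using h \<open>g \<in> ?G\<close> Suc.prems(1) W(1) generalized_eigenspace_subspace[of M \<mu>]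
      by (intro bexI[of _ "inverse c *s (g - h)"])
        (auto intro!: vec.subspace_scale vec.subspace_diff)
  qed
  then show ?thesis using g that unfolding generalized_eigenspace_def by blast
qed

text \<open>The first \<open>CARD('n) + 1\<close> Krylov vectors of \<open>x\<close> are dependent,
  which yields a nonzero polynomial \<open>p\<close> with \<open>p(M) x = 0\<close>; over the
  complex numbers it splits into linear factors.\<close>

lemma vanishing_shift_product:
  fixes M :: "complex ^ 'n ^ 'n"
  obtains zs where "foldr (\<lambda>z y. (M - mat z) *v y) zs x = 0"
proof -
  define pow where "pow i = ((\<lambda>y. M *v y) ^^ i) x" for i
  \<comment> \<open>\<open>act p\<close> is \<open>p(M) x\<close>.\<close>
  define act where "act p = (\<Sum>i\<le>degree p. coeff p i *s pow i)" for p
  have act_bound: "act p = (\<Sum>i\<le>n. coeff p i *s pow i)" if "degree p \<le> n" for p n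
    unfolding act_def using that
    by (intro sum.mono_neutral_left) (auto simp: coeff_eq_0)
  have act_linear: "act ([:-z, 1:] * q) = (M - mat z) *v act q" for z q
  proof -
    let ?n = "degree q"
    have "degree ([:-z, 1:] * q) \<le> Suc ?n"
      using degree_mult_le[of "[:-z, 1:]" q] by simp
    then have "act ([:-z, 1:] * q) = (\<Sum>i\<le>Suc ?n. coeff ([:-z, 1:] * q) i *s pow i)"
      by (rule act_bound)
    also have "\<dots> = (\<Sum>i\<le>Suc ?n. coeff (pCons 0 q) i *s pow i) - z *s (\<Sum>i\<le>Suc ?n. coeff q i *s pow i)"
      by (simp add: vec.scale_left_diff_distrib sum_subtractf vec.scale_sum_right
          vector_smult_assoc algebra_simps del: sum.atMost_Suc)
    also have "(\<Sum>i\<le>Suc ?n. coeff (pCons 0 q) i *s pow i) = (\<Sum>i\<le>?n. coeff q i *s pow (Suc i))"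
      by (subst sum.atMost_Suc_shift) simp
    also have "\<dots> = M *v (\<Sum>i\<le>?n. coeff q i *s pow i)"
      by (simp add: vec.linear_sum[OF matrix_vector_mul_linear_gen] pow_def vec.scale)
    also have "(\<Sum>i\<le>Suc ?n. coeff q i *s pow i) = act q" by (rule act_bound[symmetric]) simp
    finally show ?thesis by (simp add: act_def shift_mult_vec)
  qed
  have "\<exists>p. p \<noteq> 0 \<and> act p = 0"
  \<comment> \<open>A linear relation on the image set gives one coefficient per index only if
    \<open>pow\<close> is injective; a repetition gives an annihilating difference of two monomials
    directly.\<close>
  proof (cases "inj_on pow {..CARD('n)}")
    case False
    then obtain i j where ij: "i \<noteq> j" "pow i = pow j" by (auto simp: inj_on_def)
    let ?p = "monom 1 i - monom 1 j :: complex poly"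
    have "coeff ?p i \<noteq> 0" using ij by simp
    then have "?p \<noteq> 0" by (metis coeff_0)
    have deg: "degree ?p \<le> max i j" by (intro degree_diff_le) (auto simp: degree_monom_eq)
    have "act ?p = (\<Sum>k\<le>max i j. (if k = i then pow i else 0) - (if k = j then pow j else 0))"
      unfolding act_bound[OF deg] by (intro sum.cong) auto
    also have "\<dots> = 0" using ij by (simp add: sum_subtractf)
    finally show ?thesis using \<open>?p \<noteq> 0\<close> by blast
  next
    case True
    then have "card (pow ` {..CARD('n)}) = Suc CARD('n)" by (simp add: card_image)
    then have "vec.dependent (pow ` {..CARD('n)})"
      using vec.independent_card_le_dim[of "pow ` {..CARD('n)}" UNIV] by (auto simp: card_cart_basis)
    then obtain u v where u: "v \<in> pow ` {..CARD('n)}" "u v \<noteq> 0"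
        "(\<Sum>v\<in>pow ` {..CARD('n)}. u v *s v) = 0"
      by (subst (asm) vec.dependent_finite) auto
    define p where "p = Poly (map (u \<circ> pow) [0..<Suc CARD('n)])"
    have coeff: "coeff p i = (if i \<le> CARD('n) then u (pow i) else 0)" for i
      unfolding p_def by (auto simp: coeff_Poly_eq nth_default_def simp del: upt_Suc)
    have "p \<noteq> 0" using u(1,2) coeff by (metis atMost_iff coeff_0 imageE)
    have deg: "degree p \<le> CARD('n)" by (intro degree_le) (auto simp: coeff)
    have "act p = (\<Sum>v\<in>pow ` {..CARD('n)}. u v *s v)"
      unfolding act_bound[OF deg] using True by (simp add: sum.reindex coeff)
    then show ?thesis using u \<open>p \<noteq> 0\<close> by auto
  qed
  then obtain p where p: "p \<noteq> 0" "act p = 0" by blast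
  obtain A where A: "p = smult (lead_coeff p) (\<Prod>x\<in>#A. [:-x, 1:])"
    using alg_closed_imp_factorization[OF p(1)] by blast
  obtain zs where zs: "A = mset zs" by (metis ex_mset)
  have smult: "act (smult c q) = c *s act q" for c q
    using act_bound[of "smult c q" "degree q"]
    by (simp add: act_def vec.scale_sum_right vector_smult_assoc)
  have prod: "act (\<Prod>x\<leftarrow>zs. [:-x, 1:]) = foldr (\<lambda>z y. (M - mat z) *v y) zs x"
  proof (induction zs)
    case Nil
    show ?case by (simp add: act_def pow_def)
  next
    case (Cons z zs)
    then show ?case by (simp only: list.map prod_list.Cons act_linear foldr.simps o_apply)
  qed
  have "act p = act (smult (lead_coeff p) (\<Prod>x\<leftarrow>zs. [:-x, 1:]))"
    by (rule arg_cong[of _ _ act], subst (1) A) (simp only: zs mset_map[symmetric] prod_mset_prod_list)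
  then have "foldr (\<lambda>z y. (M - mat z) *v y) zs x = 0"
    using p by (simp only: smult prod vector_mul_eq_0 leading_coeff_0_iff) simp
  then show ?thesis by (rule that)
qed

text \<open>\<open>W\<close> is spanned by its own generalized eigenvectors: some product of shifts
  annihilates a given vector of \<open>W\<close>, and the shifts can be undone one at a time inside
  the span. The hypothesis on eigenvectors in \<open>W\<close> places all of these in the unstable
  space.\<close>

lemma invariant_subspace_subset_unstable_space:
  fixes M :: "complex ^ 'n ^ 'n"
  assumes W: "vec.subspace W" "\<And>x. x \<in> W \<Longrightarrow> M *v x \<in> W"
    and pos: "\<And>y \<mu>. y \<in> W \<Longrightarrow> y \<noteq> 0 \<Longrightarrow> M *v y = \<mu> *s y \<Longrightarrow> Re \<mu> > 0"
  shows "W \<subseteq> unstable_space M"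
proof
  fix x assume "x \<in> W"
  define S where "S = (\<Union>\<mu>\<in>{\<mu>. eigenvalue M \<mu> \<and> Re \<mu> > 0}. generalized_eigenspace M \<mu> \<inter> W)"
  have gen: "y \<in> vec.span S" if y: "y \<in> W" "y \<in> generalized_eigenspace M \<mu>" for y \<mu>
  proof (cases "y = 0")
    case False
    then obtain e where "e \<in> W" "e \<noteq> 0" "M *v e = \<mu> *s e"
      using eigenvector_in_invariant_subspace[OF W y(1) _ y(2)] by blast
    then have "y \<in> S" using pos y unfolding S_def eigenvalue_def by blast
    then show ?thesis by (rule vec.span_base)
  qed (simp add: vec.span_zero)
  \<comment> \<open>The shift by \<open>z\<close> is onto on generalized eigenspaces for
    \<open>\<mu> \<noteq> z\<close>, so only a part belonging to \<open>z\<close> itself is left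
    over as \<open>g\<close>.\<close>
  have split: "\<exists>h\<in>vec.span S. \<exists>g\<in>W \<inter> generalized_eigenspace M z. e = (M - mat z) *v h + g"
    if "e \<in> vec.span S" for e z
    using that
  proof (induction rule: vec.span_induct_alt)
    case base
    show ?case
      using W(1) by (intro bexI[of _ 0])
        (auto simp: vec.subspace_0 generalized_eigenspace_subspace vec.span_zero)
  next
    case (step c s e)
    then obtain \<mu> where \<mu>: "s \<in> W" "s \<in> generalized_eigenspace M \<mu>" by (auto simp: S_def)
    obtain h1 g1 where 1: "h1 \<in> vec.span S" "g1 \<in> W" "g1 \<in> generalized_eigenspace M z"
        "s = (M - mat z) *v h1 + g1"
    proof (cases "\<mu> = z")
      case True
      then show ?thesis using that[of 0 s] \<mu> by (simp add: vec.span_zero)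
    next
      case False
      then obtain h where "h \<in> W" "h \<in> generalized_eigenspace M \<mu>" "(M - mat z) *v h = s"
        using shift_surj_on_generalized_eigenspace[OF W \<mu>, of z] by blast
      then show ?thesis
        using that[of h 0] gen W(1)
        by (auto simp: vec.subspace_0 generalized_eigenspace_subspace)
    qed
    obtain h2 g2 where 2: "h2 \<in> vec.span S" "g2 \<in> W" "g2 \<in> generalized_eigenspace M z"
        "e = (M - mat z) *v h2 + g2"
      using step by blast
    show ?case
    proof (intro bexI)
      show "c *s s + e = (M - mat z) *v (c *s h1 + h2) + (c *s g1 + g2)"
        by (simp add: 1(4) 2(4) matrix_vector_right_distrib vec.scale vec.scale_right_distrib)
      show "c *s g1 + g2 \<in> W \<inter> generalized_eigenspace M z"
        using 1 2 W(1) generalized_eigenspace_subspace[of M z]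
        by (auto intro!: vec.subspace_add vec.subspace_scale)
      show "c *s h1 + h2 \<in> vec.span S"
        using 1 2 by (auto intro!: vec.span_add vec.span_scale)
    qed
  qed
  have "vec.span S \<subseteq> W"
    using W(1) by (intro vec.span_minimal) (auto simp: S_def)
  \<comment> \<open>Correcting \<open>x\<close> by \<open>h\<close> leaves
    \<open>(M - mat z) *v (x - h) = g\<close>, so \<open>x - h\<close> is itself a generalized
    eigenvector for \<open>z\<close>.\<close>
  have lift: "x \<in> vec.span S" if x: "x \<in> W" "(M - mat z) *v x \<in> vec.span S" for x z
  proof -
    obtain h g where hg: "h \<in> vec.span S" "g \<in> generalized_eigenspace M z"
        "(M - mat z) *v x = (M - mat z) *v h + g"
      using split[OF x(2), of z] by blast
    obtain k where "((\<lambda>y. (M - mat z) *v y) ^^ k) g = 0"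
      using hg(2) unfolding generalized_eigenspace_def by blast
    then have "((\<lambda>y. (M - mat z) *v y) ^^ Suc k) (x - h) = 0"
      using hg(3) by (simp add: funpow_Suc_right matrix_vector_mult_diff_distrib del: funpow.simps)
    then have "x - h \<in> generalized_eigenspace M z" unfolding generalized_eigenspace_def by blast
    moreover have "x - h \<in> W"
      using x(1) hg(1) \<open>vec.span S \<subseteq> W\<close> W(1) by (auto intro: vec.subspace_diff)
    ultimately have "x - h \<in> vec.span S" by (rule gen[rotated])
    then show ?thesis using hg(1) vec.span_add by fastforce
  qed
  \<comment> \<open>Backwards through a vanishing product: its value 0 lies in the span, and
    \<open>lift\<close> peels off one factor at a time.\<close>
  have "x \<in> vec.span S" if "x \<in> W" "foldr (\<lambda>z y. (M - mat z) *v y) zs x \<in> vec.span S" for zs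
    using that(2)
  proof (induction zs)
    case (Cons z zs)
    have "foldr (\<lambda>z y. (M - mat z) *v y) zs x \<in> W"
      using that(1) by (induction zs) (auto intro: shift_in_subspace[OF W])
    then show ?case using Cons lift by simp
  qed simp
  then have "x \<in> vec.span S"
    using vanishing_shift_product[of M x] \<open>x \<in> W\<close> vec.span_zero by metis
  also have "vec.span S \<subseteq> unstable_space M"
    unfolding unstable_space_def S_def by (intro vec.span_mono) blast
  finally show "x \<in> unstable_space M" .
qed

section \<open>Deflation of two eigenvalues\<close>

definition entry_norm :: "complex ^ 'n ^ 'm \<Rightarrow> real" where
  "entry_norm A = (\<Sum>i\<in>UNIV. \<Sum>j\<in>UNIV. norm (A $ i $ j))"

text \<open>The sum of the moduli of the entries is a crude bound for the operator norm, but it is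
  visibly continuous in the matrix.\<close>

lemma norm_mult_vec_le: "norm (A *v x) \<le> entry_norm A * norm x"
proof -
  have "norm (A *v x) \<le> (\<Sum>i\<in>UNIV. norm ((A *v x) $ i))"
    unfolding norm_vec_def by (intro L2_set_le_sum) simp
  also have "\<dots> \<le> (\<Sum>i\<in>UNIV. \<Sum>j\<in>UNIV. norm (A $ i $ j) * norm x)"
    unfolding matrix_vector_mult_def
    by (auto intro!: sum_mono order_trans[OF norm_sum] mult_left_mono Finite_Cartesian_Product.norm_nth_le simp: norm_mult)
  finally show ?thesis by (simp add: entry_norm_def sum_distrib_right)
qed

lemma tendsto_entry_norm:
  assumes "(A \<longlongrightarrow> A0) F"
  shows "((\<lambda>p. entry_norm (A p)) \<longlongrightarrow> entry_norm A0) F"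
  unfolding entry_norm_def by (intro tendsto_intros assms)

lemma tendsto_entry_norm_diff:
  assumes "(A \<longlongrightarrow> A0) F"
  shows "((\<lambda>p. entry_norm (A p - A0)) \<longlongrightarrow> 0) F"
  using tendsto_entry_norm[OF tendsto_diff[OF assms tendsto_const[of A0]]]
  by (simp add: entry_norm_def)

lemma tendsto_mat_mult [tendsto_intros]:
  fixes A :: "'p \<Rightarrow> complex ^ 'n ^ 'm" and B :: "'p \<Rightarrow> complex ^ 'k ^ 'n"
  assumes "(A \<longlongrightarrow> A0) F" "(B \<longlongrightarrow> B0) F"
  shows "((\<lambda>p. A p ** B p) \<longlongrightarrow> A0 ** B0) F"
  unfolding matrix_matrix_mult_def
  by (intro vec_tendstoI) (auto intro!: tendsto_intros assms)

lemma tendsto_mat_mult_vec [tendsto_intros]: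
  fixes A :: "'p \<Rightarrow> complex ^ 'n ^ 'm"
  assumes "(A \<longlongrightarrow> A0) F" "(x \<longlongrightarrow> x0) F"
  shows "((\<lambda>p. A p *v x p) \<longlongrightarrow> A0 *v x0) F"
  unfolding matrix_vector_mult_def
  by (intro vec_tendstoI) (auto intro!: tendsto_intros assms)

lemma tendsto_vector_smult [tendsto_intros]:
  fixes x :: "'p \<Rightarrow> complex ^ 'n"
  assumes "(c \<longlongrightarrow> c0) F" "(x \<longlongrightarrow> x0) F"
  shows "((\<lambda>p. c p *s x p) \<longlongrightarrow> c0 *s x0) F"
  unfolding vector_scalar_mult_def
  by (intro vec_tendstoI) (auto intro!: tendsto_intros assms)

lemma tendsto_mat [tendsto_intros]:
  assumes "(c \<longlongrightarrow> c0) F"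
  shows "((\<lambda>p. mat (c p) :: complex ^ 'n ^ 'n) \<longlongrightarrow> mat c0) F"
  unfolding mat_def by (intro vec_tendstoI) (auto intro!: tendsto_intros assms)

text \<open>By compactness \<open>h\<close> has a positive lower bound on \<open>c *s z\<close> over
  unit vectors \<open>z\<close> in \<open>K\<close>, and \<open>A p\<close> is uniformly close to
  multiplication by \<open>c\<close> there; homogeneity extends positivity to all of
  \<open>K\<close>.\<close>

lemma eventually_form_pos_on_subspace:
  fixes A :: "'p \<Rightarrow> complex ^ 'n ^ 'n" and h :: "complex ^ 'n \<Rightarrow> real"
  assumes A: "(A \<longlongrightarrow> A0) F" and A0: "\<And>z. z \<in> K \<Longrightarrow> A0 *v z = c *s z" and "c \<noteq> 0"
    and K: "vec.subspace K" "closed K"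
    and h: "continuous_on UNIV h" "\<And>c x. h (c *s x) = (cmod c)\<^sup>2 * h x"
      "\<And>z. z \<in> K \<Longrightarrow> z \<noteq> 0 \<Longrightarrow> h z > 0"
  shows "\<forall>\<^sub>F p in F. \<forall>z\<in>K. z \<noteq> 0 \<longrightarrow> h (A p *v z) > 0"
proof -
  define C where "C = K \<inter> sphere 0 1"
  have "compact C" unfolding C_def using K(2) by (intro closed_Int_compact) auto
  have pos: "h (c *s z) > 0" if "z \<in> C" for z
    using that \<open>c \<noteq> 0\<close> unfolding h(2) by (auto simp: C_def intro!: mult_pos_pos h(3))
  \<comment> \<open>For trivial \<open>K\<close> the set \<open>C\<close> is empty and any
    \<open>\<delta>\<close> serves.\<close>
  have "\<exists>\<delta>>0. \<forall>z\<in>C. h (c *s z) \<ge> \<delta>"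
  proof (cases "C = {}")
    case False
    have "continuous_on C (\<lambda>z. h (c *s z))"
      unfolding h(2) by (intro continuous_intros continuous_on_subset[OF h(1)]) auto
    then obtain z where "z \<in> C" "\<forall>y\<in>C. h (c *s z) \<le> h (c *s y)"
      using continuous_attains_inf[OF \<open>compact C\<close> False] by blast
    then show ?thesis using pos by blast
  qed (auto intro: exI[of _ 1])
  then obtain \<delta> where \<delta>: "\<delta> > 0" "\<And>z. z \<in> C \<Longrightarrow> h (c *s z) \<ge> \<delta>" by blast
  \<comment> \<open>For unit \<open>z\<close> in \<open>K\<close> this ball holds
    \<open>c *s z\<close> and, once the entry norm of \<open>A p - A0\<close> is below 1, also
    \<open>A p *v z\<close>.\<close>
  have "uniformly_continuous_on (cball 0 (cmod c + 1)) h"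
    by (intro compact_uniformly_continuous continuous_on_subset[OF h(1)]) auto
  then obtain \<eta> where \<eta>: "\<eta> > 0"
    "\<And>x y. x \<in> cball 0 (cmod c + 1) \<Longrightarrow> y \<in> cball 0 (cmod c + 1) \<Longrightarrow> dist y x < \<eta> \<Longrightarrow> dist (h y) (h x) < \<delta>"
    using \<delta>(1) unfolding uniformly_continuous_on_def by meson
  have norm_smult: "norm (c *s z) = cmod c * norm z" for c and z :: "complex ^ 'n"
    by (simp add: norm_vec_def norm_mult L2_set_right_distrib)
  have "\<forall>\<^sub>F p in F. entry_norm (A p - A0) < min \<eta> 1"
    using tendsto_entry_norm_diff[OF A] \<eta>(1) by (intro order_tendstoD(2)) auto
  then show ?thesis
  proof eventually_elim
    case (elim p)
    have unit: "h (A p *v z) > 0" if "z \<in> C" for z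
    proof -
      have "norm (A p *v z - c *s z) = norm ((A p - A0) *v z)"
        using A0[of z] that by (simp add: C_def matrix_vector_mult_diff_rdistrib)
      also have "\<dots> \<le> entry_norm (A p - A0)"
        using norm_mult_vec_le[of "A p - A0" z] that by (simp add: C_def)
      finally have d: "norm (A p *v z - c *s z) < min \<eta> 1" using elim by linarith
      have c: "norm (c *s z) = cmod c" using that by (simp add: C_def norm_smult)
      have "norm (A p *v z) \<le> cmod c + 1"
        using d c norm_triangle_ineq2[of "A p *v z" "c *s z"] by linarith
      then have "dist (h (A p *v z)) (h (c *s z)) < \<delta>"
        using d c by (intro \<eta>(2)) (auto simp: dist_norm)
      then show ?thesis using \<delta>(2)[OF that] by (auto simp: dist_real_def)
    qed
    show ?case
    proof safe
      fix z assume z: "z \<in> K" "z \<noteq> 0"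
      define r where "r = complex_of_real (norm z)"
      have "r \<noteq> 0" using z by (simp add: r_def)
      have "inverse r *s z \<in> C"
        using z K(1) by (simp add: C_def norm_smult vec.subspace_scale norm_inverse r_def)
      then have "h (A p *v (inverse r *s z)) > 0" by (rule unit)
      then show "h (A p *v z) > 0"
        using \<open>r \<noteq> 0\<close> by (simp add: vec.scale h(2) zero_less_mult_iff)
    qed
  qed
qed

text \<open>Each basis vector of a limit space is a limit of vectors from \<open>E p\<close>. This
  bounds every limit space from above, which stands in for uniqueness of limits.\<close>

lemma subspace_tendsto_subset:
  assumes "subspace_tendsto E E0 F" "F \<noteq> bot" "vec.subspace K"
    and "\<And>x x0. \<forall>\<^sub>F p in F. x p \<in> E p \<Longrightarrow> (x \<longlongrightarrow> x0) F \<Longrightarrow> x0 \<in> K"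
  shows "E0 \<subseteq> K"
proof -
  obtain n b b0 where b: "\<forall>\<^sub>F p in F. indexed_basis {..<n::nat} (b p) (E p)"
      "indexed_basis {..<n} b0 E0" "\<And>i. i < n \<Longrightarrow> ((\<lambda>p. b p i) \<longlongrightarrow> b0 i) F"
    using assms(1) unfolding subspace_tendsto_def by blast
  have "b0 i \<in> K" if "i < n" for i
  proof (rule assms(4)[OF _ b(3)[OF that]])
    show "\<forall>\<^sub>F p in F. b p i \<in> E p"
      using b(1) by eventually_elim (use that in \<open>auto simp: indexed_basis_def intro: vec.span_base\<close>)
  qed
  then have "vec.span (b0 ` {..<n}) \<subseteq> K" using assms(3) by (intro vec.span_minimal) auto
  then show ?thesis using b(2) by (simp add: indexed_basis_def)
qed

section \<open>Splitting off two eigenvalues by a polynomial in the matrix\<close>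

definition deflate :: "complex ^ 'n ^ 'n \<Rightarrow> complex \<Rightarrow> complex \<Rightarrow> complex ^ 'n ^ 'n" where
  "deflate M \<mu>1 \<mu>2 = (M - mat \<mu>1) ** (M - mat \<mu>2)"

lemma deflate_mult_vec: "deflate M \<mu>1 \<mu>2 *v x = (M - mat \<mu>1) *v ((M - mat \<mu>2) *v x)"
  by (simp add: deflate_def matrix_vector_mul_assoc)

lemma deflate_commute: "M *v (deflate M \<mu>1 \<mu>2 *v x) = deflate M \<mu>1 \<mu>2 *v (M *v x)"
  by (simp add: deflate_mult_vec shift_mult_vec matrix_vector_mult_diff_distrib vec.scale
      vec.scale_right_diff_distrib)

text \<open>\<open>K\<close> need not be invariant under \<open>M\<close>: together with the two
  eigenvectors it spans the whole space. Since \<open>deflate\<close> annihilates both eigenvectors,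
  the image of \<open>K\<close> is its full range, and this is invariant.\<close>

locale deflation =
  fixes M :: "complex ^ 'n ^ 'n" and \<mu>1 \<mu>2 :: complex and e1 e2 :: "complex ^ 'n"
    and K :: "(complex ^ 'n) set"
  assumes subspace_K: "vec.subspace K"
    and eig1: "M *v e1 = \<mu>1 *s e1" and eig2: "M *v e2 = \<mu>2 *s e2"
    and decomp: "\<And>x. \<exists>k\<in>K. \<exists>\<alpha> \<beta>. x = k + \<alpha> *s e1 + \<beta> *s e2"
    and inj: "\<And>z. z \<in> K \<Longrightarrow> z \<noteq> 0 \<Longrightarrow> deflate M \<mu>1 \<mu>2 *v z \<noteq> 0"
    and pos: "\<And>z \<mu>. z \<in> K \<Longrightarrow> z \<noteq> 0 \<Longrightarrow>
      M *v (deflate M \<mu>1 \<mu>2 *v z) = \<mu> *s (deflate M \<mu>1 \<mu>2 *v z) \<Longrightarrow> Re \<mu> > 0"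
begin

abbreviation "Q \<equiv> deflate M \<mu>1 \<mu>2"
abbreviation "W \<equiv> (\<lambda>z. Q *v z) ` K"

lemma Q_decomp: "Q *v (k + \<alpha> *s e1 + \<beta> *s e2) = Q *v k"
proof -
  have "Q *v e1 = 0"
    by (simp add: deflate_mult_vec shift_mult_vec matrix_vector_mult_diff_distrib vec.scale eig1
        vector_smult_assoc mult.commute)
  moreover have "Q *v e2 = 0"
    by (simp add: deflate_mult_vec shift_mult_vec eig2)
  ultimately show ?thesis by (simp add: matrix_vector_right_distrib vec.scale)
qed

lemma Q_in_W: "Q *v x \<in> W"
  using decomp[of x] Q_decomp by (metis imageI)

lemma subspace_W: "vec.subspace W"
  by (intro vec.linear_subspace_image subspace_K matrix_vector_mul_linear_gen)

lemma W_invariant: "x \<in> W \<Longrightarrow> M *v x \<in> W"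
  using Q_in_W by (auto simp: deflate_commute)

lemma pos_W: "x \<in> W \<Longrightarrow> x \<noteq> 0 \<Longrightarrow> M *v x = \<mu> *s x \<Longrightarrow> Re \<mu> > 0"
  by (elim imageE) (use pos in \<open>force\<close>)

text \<open>On generalized eigenspaces for \<open>Re \<mu> > 0\<close> both shifts in
  \<open>Q\<close> are onto, because \<open>\<mu>1\<close> and \<open>\<mu>2\<close> are stable; so
  these spaces lie in the range \<open>W\<close> of \<open>Q\<close>.\<close>

lemma unstable_space_eq:
  assumes "Re \<mu>1 < 0" "Re \<mu>2 < 0"
  shows "unstable_space M = W"
proof
  show "W \<subseteq> unstable_space M"
    by (rule invariant_subspace_subset_unstable_space[OF subspace_W W_invariant pos_W])
  have "x \<in> W" if x: "x \<in> generalized_eigenspace M \<mu>" "Re \<mu> > 0" for x \<mu>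
  proof -
    have "\<mu>1 \<noteq> \<mu>" "\<mu>2 \<noteq> \<mu>" using assms x by auto
    obtain y where y: "y \<in> generalized_eigenspace M \<mu>" "(M - mat \<mu>1) *v y = x"
      using shift_surj_on_generalized_eigenspace[OF vec.subspace_UNIV _ _ x(1) \<open>\<mu>1 \<noteq> \<mu>\<close>] by blast
    obtain z where z: "(M - mat \<mu>2) *v z = y"
      using shift_surj_on_generalized_eigenspace[OF vec.subspace_UNIV _ _ y(1) \<open>\<mu>2 \<noteq> \<mu>\<close>] by blast
    show ?thesis using Q_in_W[of z] by (simp add: deflate_mult_vec y z)
  qed
  then show "unstable_space M \<subseteq> W"
    unfolding unstable_space_def by (intro vec.span_minimal subspace_W) auto
qed

lemma funpow_shift_commute:
  "((\<lambda>y. (M - mat \<mu>) *v y) ^^ k) (Q *v x) = Q *v ((\<lambda>y. (M - mat \<mu>) *v y) ^^ k) x"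
proof (induction k)
  case (Suc k)
  then show ?case
    by (simp add: shift_mult_vec deflate_commute vec.scale matrix_vector_mult_diff_distrib)
qed simp

text \<open>\<open>Q\<close> maps a stable generalized eigenvector to one in \<open>W\<close>, where
  every eigenvalue is unstable, so the image is 0 and only components along \<open>e1\<close> and
  \<open>e2\<close> remain; the latter belongs to an unstable eigenvalue and must vanish.\<close>

lemma stable_space_eq:
  assumes "Re \<mu>1 < 0" "Re \<mu>2 > 0" "e1 \<noteq> 0" "e2 \<noteq> 0"
  shows "stable_space M = vec.span {e1}"
proof
  have "e1 \<in> generalized_eigenspace M \<mu>1"
    unfolding generalized_eigenspace_def
    by (auto intro!: exI[of _ 1] simp: shift_mult_vec eig1)
  moreover have "eigenvalue M \<mu>1" using eig1 assms unfolding eigenvalue_def by blast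
  ultimately show "vec.span {e1} \<subseteq> stable_space M"
    unfolding stable_space_def using assms by (intro vec.span_mono) auto
  have "x \<in> vec.span {e1}" if x: "x \<in> generalized_eigenspace M \<mu>" "Re \<mu> < 0" for x \<mu>
  proof -
    obtain k where k: "((\<lambda>y. (M - mat \<mu>) *v y) ^^ k) x = 0"
      using x(1) unfolding generalized_eigenspace_def by blast
    then have "Q *v x \<in> generalized_eigenspace M \<mu>"
      unfolding generalized_eigenspace_def by (auto simp: funpow_shift_commute intro!: exI[of _ k])
    then have "Q *v x = 0"
      using eigenvector_in_invariant_subspace[OF subspace_W W_invariant Q_in_W[of x]] pos_W x(2)
      by (metis less_asym)
    moreover obtain z \<alpha> \<beta> where z: "z \<in> K" "x = z + \<alpha> *s e1 + \<beta> *s e2" using decomp by blast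
    ultimately have "z = 0" using Q_decomp inj by metis
    have shift: "(M - mat \<kappa>) *v e = (\<nu> - \<kappa>) *s e" if "M *v e = \<nu> *s e" for e \<nu> \<kappa>
      by (simp add: shift_mult_vec that vec.scale_left_diff_distrib)
    have pow: "((\<lambda>y. (M - mat \<mu>) *v y) ^^ k) e = (\<nu> - \<mu>) ^ k *s e"
      if "M *v e = \<nu> *s e" for e \<nu> and k
    proof (induction k)
      case (Suc k)
      have "((\<lambda>y. (M - mat \<mu>) *v y) ^^ Suc k) e = (M - mat \<mu>) *v ((\<nu> - \<mu>) ^ k *s e)"
        using Suc by simp
      also have "\<dots> = (\<nu> - \<mu>) ^ Suc k *s e"
        by (simp only: vec.scale shift[OF that] vector_smult_assoc power_Suc mult.commute)
      finally show ?case .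
    qed simp
    have "((\<lambda>y. (M - mat \<mu>) *v y) ^^ Suc k) x = 0"
      by (simp only: funpow.simps(2) o_apply k vec.zero)
    then have comb: "(\<alpha> * (\<mu>1 - \<mu>) ^ Suc k) *s e1 + (\<beta> * (\<mu>2 - \<mu>) ^ Suc k) *s e2 = 0"
      by (simp only: z(2) \<open>z = 0\<close> add_0_left funpow_shift_add funpow_shift_scale pow[OF eig1]
          pow[OF eig2] vector_smult_assoc)
    \<comment> \<open>The shift by \<open>\<mu>1\<close> removes the \<open>e1\<close> term of
      \<open>comb\<close> and isolates the coefficient of \<open>e2\<close>.\<close>
    have "(M - mat \<mu>1) *v (r *s e1 + t *s e2) = (t * (\<mu>2 - \<mu>1)) *s e2" for r t
      by (simp only: matrix_vector_right_distrib vec.scale shift[OF eig1] shift[OF eig2]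
          vector_smult_assoc diff_self vector_smult_lzero vector_smult_rzero add_0_left mult_zero_right)
    from this[of "\<alpha> * (\<mu>1 - \<mu>) ^ Suc k" "\<beta> * (\<mu>2 - \<mu>) ^ Suc k"]
    have "(\<beta> * (\<mu>2 - \<mu>) ^ Suc k * (\<mu>2 - \<mu>1)) *s e2 = 0"
      by (simp only: comb vec.zero)
    then have "\<beta> * (\<mu>2 - \<mu>) ^ Suc k * (\<mu>2 - \<mu>1) = 0"
      using assms(4) by (simp only: vector_mul_eq_0) blast
    moreover have "\<mu>2 \<noteq> \<mu>1" "\<mu>2 \<noteq> \<mu>" using assms x(2) by auto
    ultimately have "\<beta> = 0" by simp
    then show ?thesis using z(2) \<open>z = 0\<close> by (simp add: vec.span_scale vec.span_base)
  qed
  then show "stable_space M \<subseteq> vec.span {e1}"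
    unfolding stable_space_def by (intro vec.span_minimal vec.subspace_span) auto
qed

end

section \<open>Limits of stable and unstable spaces\<close>

text \<open>The product of the distances from \<open>m\<close> to all roots equals
  \<open>cmod (poly q m / lead_coeff q)\<close>, and the nearest root contributes the smallest
  factor.\<close>

lemma root_near_approximate_root:
  fixes q :: "complex poly"
  assumes "degree q > 0"
  obtains z where "poly q z = 0" "cmod (z - m) ^ degree q \<le> cmod (poly q m / lead_coeff q)"
proof -
  have "q \<noteq> 0" using assms by auto
  then obtain A where A: "size A = degree q" "q = smult (lead_coeff q) (\<Prod>x\<in>#A. [:-x, 1:])"
    using alg_closed_imp_factorization by blast
  define r where "r = Min ((\<lambda>z. cmod (z - m)) ` set_mset A)"
  have "A \<noteq> {#}" using A(1) assms by auto
  then have "r \<in> (\<lambda>z. cmod (z - m)) ` set_mset A" unfolding r_def by (intro Min_in) auto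
  then obtain z where z: "z \<in># A" "r = cmod (z - m)" by blast
  have le: "r \<le> cmod (x - m)" if "x \<in># A" for x unfolding r_def using that by (intro Min_le) auto
  have poly_q: "poly q w = lead_coeff q * (\<Prod>x\<in>#A. w - x)" for w
  proof -
    have "poly q w = lead_coeff q * poly (\<Prod>x\<in>#A. [:-x, 1:]) w"
      by (subst A(2)) simp
    also have "poly (\<Prod>x\<in>#A. [:-x, 1:]) w = (\<Prod>x\<in>#A. w - x)"
      by (induction A) (auto simp: algebra_simps)
    finally show ?thesis .
  qed
  have "r ^ size B \<le> cmod (\<Prod>x\<in>#B. m - x)" if "B \<subseteq># A" for B
    using that
  proof (induction B)
    case (add x B)
    have "r * r ^ size B \<le> cmod (m - x) * cmod (\<Prod>x\<in>#B. m - x)"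
      using add le[of x] z(2) mset_subset_eq_insertD[OF add.prems]
      by (intro mult_mono) (auto simp: norm_minus_commute subset_mset.less_imp_le)
    then show ?case by (simp add: norm_mult)
  qed auto
  from this[of A] have "r ^ degree q \<le> cmod (poly q m / lead_coeff q)"
    using \<open>q \<noteq> 0\<close> A(1) by (simp add: poly_q)
  moreover have "poly q z = 0"
    using z(1) by (simp add: poly_q prod_mset_zero_iff)
  ultimately show ?thesis using that z(2) by blast
qed

text \<open>The root nearest to \<open>m\<close> is at distance at most the \<open>n\<close>-th root
  of \<open>cmod (poly (q p) m / l)\<close>. Fixing the degree and the leading coefficient makes
  this bound tend to 0.\<close>

lemma tendsto_root:
  fixes q :: "'p \<Rightarrow> complex poly"
  assumes "\<And>p. degree (q p) = n" "n > 0" "\<And>p. lead_coeff (q p) = l"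
    and "((\<lambda>p. poly (q p) m) \<longlongrightarrow> 0) F"
  obtains \<mu> where "\<And>p. poly (q p) (\<mu> p) = 0" "(\<mu> \<longlongrightarrow> m) F"
proof -
  have "\<exists>z. poly (q p) z = 0 \<and> cmod (z - m) ^ n \<le> cmod (poly (q p) m / l)" for p
    using root_near_approximate_root[of "q p" m] assms by (metis (no_types))
  then obtain \<mu> where \<mu>: "\<And>p. poly (q p) (\<mu> p) = 0"
      "\<And>p. cmod (\<mu> p - m) ^ n \<le> cmod (poly (q p) m / l)" by metis
  have "l \<noteq> 0" using assms(1,2,3) by (metis degree_0 leading_coeff_0_iff less_irrefl)
  have "((\<lambda>p. root n (cmod (poly (q p) m / l))) \<longlongrightarrow> root n (cmod (0 / l))) F"
    using \<open>l \<noteq> 0\<close> by (intro tendsto_intros assms)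
  then have "((\<lambda>p. root n (cmod (poly (q p) m / l))) \<longlongrightarrow> 0) F" by simp
  moreover have "cmod (\<mu> p - m) \<le> root n (cmod (poly (q p) m / l))" for p
    using real_root_le_mono[OF assms(2) \<mu>(2)[of p]] assms(2) by (simp add: real_root_power_cancel)
  ultimately have "((\<lambda>p. \<mu> p - m) \<longlongrightarrow> 0) F"
    by (intro Lim_null_comparison[of "\<lambda>p. \<mu> p - m"]) auto
  then show ?thesis using that[OF \<mu>(1)] by (simp add: LIM_zero_cancel)
qed

section \<open>Linear functionals (without conjugation) and kernels\<close>

definition pairing :: "complex ^ 'n \<Rightarrow> complex ^ 'n \<Rightarrow> complex" where
  "pairing \<phi> x = (\<Sum>i\<in>UNIV. \<phi> $ i * x $ i)"

lemma pairing_simps [simp]: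
  "pairing \<phi> (x + y) = pairing \<phi> x + pairing \<phi> y"
  "pairing \<phi> (x - y) = pairing \<phi> x - pairing \<phi> y"
  "pairing \<phi> (c *s x) = c * pairing \<phi> x"
  "pairing \<phi> 0 = 0"
  by (simp_all add: pairing_def algebra_simps sum.distrib sum_subtractf sum_distrib_left)

lemma tendsto_pairing [tendsto_intros]:
  "(x \<longlongrightarrow> x0) F \<Longrightarrow> ((\<lambda>p. pairing \<phi> (x p)) \<longlongrightarrow> pairing \<phi> x0) F"
  unfolding pairing_def by (intro tendsto_intros)

lemma subspace_kernel: "vec.subspace {x. (A :: complex ^ 'n ^ 'm) *v x = 0}"
  by (simp add: vec.subspace_def matrix_vector_right_distrib vec.scale)

lemma closed_kernel: "closed {x. (A :: complex ^ 'n ^ 'm) *v x = 0}"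
proof (rule closed_Collect_eq)
  show "continuous_on UNIV (\<lambda>x. A *v x)"
    unfolding continuous_on_def by (auto intro!: tendsto_intros)
qed auto

text \<open>Cramer's rule: \<open>\<alpha>\<close> and \<open>\<beta>\<close> solve the two
  equations that make both functionals vanish on the remainder; the second hypothesis says that
  their determinant is nonzero.\<close>

lemma combination_of_kernel_and_pair:
  assumes "\<And>x. A *v x = 0 \<longleftrightarrow> pairing \<phi>1 x = 0 \<and> pairing \<phi>2 x = 0"
    and "pairing \<phi>1 e1 * pairing \<phi>2 e2 \<noteq> pairing \<phi>1 e2 * pairing \<phi>2 e1"
  shows "\<exists>k\<in>{x. A *v x = 0}. \<exists>\<alpha> \<beta>. x = k + \<alpha> *s e1 + \<beta> *s e2"
proof -
  define D where "D = pairing \<phi>1 e1 * pairing \<phi>2 e2 - pairing \<phi>1 e2 * pairing \<phi>2 e1"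
  have "D \<noteq> 0" using assms(2) by (simp add: D_def)
  define \<alpha> where "\<alpha> = (pairing \<phi>1 x * pairing \<phi>2 e2 - pairing \<phi>1 e2 * pairing \<phi>2 x) / D"
  define \<beta> where "\<beta> = (pairing \<phi>1 e1 * pairing \<phi>2 x - pairing \<phi>1 x * pairing \<phi>2 e1) / D"
  have *: "\<alpha> * D = pairing \<phi>1 x * pairing \<phi>2 e2 - pairing \<phi>1 e2 * pairing \<phi>2 x"
      "\<beta> * D = pairing \<phi>1 e1 * pairing \<phi>2 x - pairing \<phi>1 x * pairing \<phi>2 e1"
    using \<open>D \<noteq> 0\<close> by (simp_all add: \<alpha>_def \<beta>_def)
  have "(pairing \<phi> x - \<alpha> * pairing \<phi> e1 - \<beta> * pairing \<phi> e2) * D =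
      pairing \<phi> x * D - (\<alpha> * D) * pairing \<phi> e1 - (\<beta> * D) * pairing \<phi> e2" for \<phi>
    by (simp add: algebra_simps)
  then have "(pairing \<phi>1 x - \<alpha> * pairing \<phi>1 e1 - \<beta> * pairing \<phi>1 e2) * D = 0"
      "(pairing \<phi>2 x - \<alpha> * pairing \<phi>2 e1 - \<beta> * pairing \<phi>2 e2) * D = 0"
    by (simp_all add: * ) (simp_all add: D_def algebra_simps)
  then have "A *v (x - \<alpha> *s e1 - \<beta> *s e2) = 0" using \<open>D \<noteq> 0\<close> by (simp add: assms(1))
  then show ?thesis
    by (intro bexI[of _ "x - \<alpha> *s e1 - \<beta> *s e2"] exI[of _ \<alpha>] exI[of _ \<beta>]) auto
qed

text \<open>The form \<open>h\<close> detects the sign of the real part of an eigenvalue from its eigenvector. As it is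
  positive on the kernel of the limit matrix \<open>L0\<close>, all eigenvalues that tend to \<open>0\<close> are unstable.\<close>

locale deflation_limit =
  fixes F :: "'p filter" and L :: "'p \<Rightarrow> complex ^ 'n ^ 'n" and L0 :: "complex ^ 'n ^ 'n"
    and \<mu>1 \<mu>2 :: "'p \<Rightarrow> complex" and m1 m2 :: complex
    and e1 e2 :: "'p \<Rightarrow> complex ^ 'n" and d1 d2 :: "complex ^ 'n"
    and \<phi>1 \<phi>2 :: "complex ^ 'n" and h :: "complex ^ 'n \<Rightarrow> real"
  assumes F: "F \<noteq> bot"
    and L: "(L \<longlongrightarrow> L0) F"
    and \<mu>1: "(\<mu>1 \<longlongrightarrow> m1) F" and \<mu>2: "(\<mu>2 \<longlongrightarrow> m2) F"
    and m: "m1 \<noteq> 0" "m2 \<noteq> 0" "m1 \<noteq> m2"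
    and e1: "(e1 \<longlongrightarrow> d1) F" and e2: "(e2 \<longlongrightarrow> d2) F"
    and eig1: "\<And>p. L p *v e1 p = \<mu>1 p *s e1 p" and eig2: "\<And>p. L p *v e2 p = \<mu>2 p *s e2 p"
    and kernel: "\<And>x. L0 *v x = 0 \<longleftrightarrow> pairing \<phi>1 x = 0 \<and> pairing \<phi>2 x = 0"
    and D: "pairing \<phi>1 d1 * pairing \<phi>2 d2 \<noteq> pairing \<phi>1 d2 * pairing \<phi>2 d1"
    and h: "continuous_on UNIV h" "\<And>c x. h (c *s x) = (cmod c)\<^sup>2 * h x"
      "\<And>z. L0 *v z = 0 \<Longrightarrow> z \<noteq> 0 \<Longrightarrow> h z > 0"
    and sign: "\<forall>\<^sub>F p in F. \<forall>x \<mu>. x \<noteq> 0 \<longrightarrow> L p *v x = \<mu> *s x \<longrightarrow> 0 < Re \<mu> * h x"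
begin

abbreviation "K \<equiv> {x. L0 *v x = 0}"
abbreviation "Q p \<equiv> deflate (L p) (\<mu>1 p) (\<mu>2 p)"

lemma tendsto_Q: "(Q \<longlongrightarrow> deflate L0 m1 m2) F"
  unfolding deflate_def by (intro tendsto_intros L \<mu>1 \<mu>2)

lemma Q0_kernel: "z \<in> K \<Longrightarrow> deflate L0 m1 m2 *v z = (m1 * m2) *s z"
  by (simp add: deflate_mult_vec shift_mult_vec vec.neg vec.scale vector_smult_assoc)

lemma nonzero_vectors: "d1 \<noteq> 0" "d2 \<noteq> 0"
  using D by auto

text \<open>The determinant in \<open>D\<close> stays nonzero near the limit, which gives the
  decomposition. On \<open>K\<close> the matrices \<open>Q p\<close> tend to multiplication by
  \<open>m1 * m2\<close>, so \<open>h\<close> is positive on the image of \<open>K\<close>, and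
  \<open>sign\<close> turns this into \<open>Re \<mu> > 0\<close>.\<close>

lemma eventually_deflation: "\<forall>\<^sub>F p in F. deflation (L p) (\<mu>1 p) (\<mu>2 p) (e1 p) (e2 p) K"
proof -
  have "((\<lambda>p. pairing \<phi>1 (e1 p) * pairing \<phi>2 (e2 p) - pairing \<phi>1 (e2 p) * pairing \<phi>2 (e1 p)) \<longlongrightarrow>
      pairing \<phi>1 d1 * pairing \<phi>2 d2 - pairing \<phi>1 d2 * pairing \<phi>2 d1) F"
    by (intro tendsto_intros e1 e2)
  then have D': "\<forall>\<^sub>F p in F. pairing \<phi>1 (e1 p) * pairing \<phi>2 (e2 p) - pairing \<phi>1 (e2 p) * pairing \<phi>2 (e1 p) \<noteq> 0"
    using D by (intro tendsto_imp_eventually_ne) auto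
  have "\<forall>\<^sub>F p in F. \<forall>z\<in>K. z \<noteq> 0 \<longrightarrow> h (Q p *v z) > 0"
    using m h by (intro eventually_form_pos_on_subspace[OF tendsto_Q Q0_kernel _ subspace_kernel closed_kernel]) auto
  with D' sign show ?thesis
  proof eventually_elim
    case (elim p)
    show ?case
    proof
      show "\<exists>k\<in>K. \<exists>\<alpha> \<beta>. x = k + \<alpha> *s e1 p + \<beta> *s e2 p" for x
        using elim by (intro combination_of_kernel_and_pair[OF kernel]) auto
      fix z assume z: "z \<in> K" "z \<noteq> 0"
      have "h 0 = 0" using h(2)[of 0 0] by simp
      with z elim show ne: "Q p *v z \<noteq> 0" by force
      show "Re \<mu> > 0" if "L p *v (Q p *v z) = \<mu> *s (Q p *v z)" for \<mu>
      proof -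
        have "0 < Re \<mu> * h (Q p *v z)" "0 < h (Q p *v z)" using that ne elim z by auto
        then show ?thesis by (simp add: zero_less_mult_iff)
      qed
    qed (use eig1 eig2 subspace_kernel in auto)
  qed
qed

text \<open>A limit eigenvalue on the imaginary axis does not reveal on which side its
  approximations lie; the sign of \<open>h\<close> at the limit eigenvector does.\<close>

lemma eventually_Re_neg:
  assumes "h d < 0" "(e \<longlongrightarrow> d) F" "\<And>p. L p *v e p = \<mu> p *s e p"
  shows "\<forall>\<^sub>F p in F. Re (\<mu> p) < 0"
proof -
  have "isCont h d" using h(1) by (simp add: continuous_on_eq_continuous_at)
  then have "((\<lambda>p. h (e p)) \<longlongrightarrow> h d) F" using assms(2) by (rule isCont_tendsto_compose)
  then have "\<forall>\<^sub>F p in F. h (e p) < 0" using assms(1) by (rule order_tendstoD(2))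
  with sign show ?thesis
  proof eventually_elim
    case (elim p)
    have "h 0 = 0" using h(2)[of 0 0] by simp
    then have "e p \<noteq> 0" using elim by auto
    then have "0 < Re (\<mu> p) * h (e p)" using elim assms(3) by blast
    then show ?case using elim by (simp add: zero_less_mult_iff)
  qed
qed

lemma eventually_unstable_space:
  assumes "h d1 < 0" "h d2 < 0"
  shows "\<forall>\<^sub>F p in F. unstable_space (L p) = (\<lambda>z. Q p *v z) ` K"
  using eventually_deflation eventually_Re_neg[OF assms(1) e1 eig1] eventually_Re_neg[OF assms(2) e2 eig2]
  by eventually_elim (rule deflation.unstable_space_eq)

text \<open>The nearby bases are images of \<open>b0\<close> under \<open>Q p\<close>; the factor
  \<open>c\<close> cancels the limit action \<open>m1 * m2\<close> of \<open>Q p\<close> on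
  \<open>K\<close>, so that they converge to \<open>b0\<close> itself.\<close>

lemma unstable_space_tendsto_kernel:
  assumes neg: "h d1 < 0" "h d2 < 0" and b0: "indexed_basis {..<n::nat} b0 K"
  shows "subspace_tendsto (\<lambda>p. unstable_space (L p)) K F"
  unfolding subspace_tendsto_def
proof (intro exI conjI allI impI)
  define c where "c = inverse (m1 * m2)"
  have "c \<noteq> 0" using m by (simp add: c_def)
  show "\<forall>\<^sub>F p in F. indexed_basis {..<n} (\<lambda>i. c *s (Q p *v b0 i)) (unstable_space (L p))"
    using eventually_deflation eventually_unstable_space[OF neg]
  proof eventually_elim
    case (elim p)
    let ?f = "\<lambda>z. c *s (Q p *v z)"
    have f: "?f = (\<lambda>z. (mat c ** Q p) *v z)"
      by (simp add: matrix_vector_mul_assoc[symmetric] mat_mult_vec)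
    have lin: "Vector_Spaces.linear (*s) (*s) ?f" unfolding f by (rule matrix_vector_mul_linear_gen)
    have span: "vec.span (b0 ` {..<n}) = K" and ind: "vec.independent (b0 ` {..<n})"
      and inj_b: "inj_on b0 {..<n}"
      using b0 by (auto simp: indexed_basis_def)
    have inj_f: "inj_on ?f K"
    proof (rule inj_onI)
      fix x y assume xy: "x \<in> K" "y \<in> K" "?f x = ?f y"
      then have "Q p *v (x - y) = 0" using \<open>c \<noteq> 0\<close> by (simp add: matrix_vector_mult_diff_distrib)
      moreover have "x - y \<in> K" using xy by (simp add: matrix_vector_mult_diff_distrib)
      ultimately show "x = y" using deflation.inj[OF elim(1), of "x - y"] by auto
    qed
    have im: "(\<lambda>i. ?f (b0 i)) ` {..<n} = ?f ` (b0 ` {..<n})" by (simp add: image_image)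
    have "inj_on (\<lambda>i. ?f (b0 i)) {..<n}"
      using comp_inj_on[OF inj_b inj_on_subset[OF inj_f]] vec.span_superset[of "b0 ` {..<n}"]
      unfolding span by (simp add: o_def)
    moreover have "vec.independent (?f ` (b0 ` {..<n}))"
      using inj_f span by (intro vec.linear_independent_injective_image[OF lin ind]) auto
    moreover have "vec.span (?f ` (b0 ` {..<n})) = unstable_space (L p)"
    proof -
      have "vec.span (?f ` (b0 ` {..<n})) = ?f ` K" using vec.linear_span_image[OF lin] span by simp
      also have "\<dots> = (\<lambda>z. Q p *v z) ` K"
      proof safe
        fix z assume "L0 *v z = 0"
        then have *: "c *s z \<in> K" "inverse c *s z \<in> K" by (simp_all add: vec.scale)
        have "?f z = Q p *v (c *s z)" "Q p *v z = ?f (inverse c *s z)"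
          using \<open>c \<noteq> 0\<close> by (simp_all add: vec.scale vector_smult_assoc)
        then show "?f z \<in> (\<lambda>z. Q p *v z) ` K" "Q p *v z \<in> ?f ` K" using * by blast+
      qed
      finally show ?thesis using elim by simp
    qed
    ultimately show ?case by (simp add: indexed_basis_def im)
  qed
  show "indexed_basis {..<n} b0 K" by (rule b0)
  show "((\<lambda>p. c *s (Q p *v b0 i)) \<longlongrightarrow> b0 i) F" if "i < n" for i
  proof -
    have "b0 i \<in> vec.span (b0 ` {..<n})" using that by (intro vec.span_base) simp
    then have "b0 i \<in> K" using b0 unfolding indexed_basis_def by simp
    then have "c *s (deflate L0 m1 m2 *v b0 i) = b0 i"
      using m by (simp add: Q0_kernel c_def vector_smult_assoc field_simps)
    moreover have "((\<lambda>p. c *s (Q p *v b0 i)) \<longlongrightarrow> c *s (deflate L0 m1 m2 *v b0 i)) F"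
      by (intro tendsto_intros tendsto_Q)
    ultimately show ?thesis by simp
  qed
qed

text \<open>If \<open>x = Q z\<close> with \<open>z\<close> in the limit kernel, then \<open>L x = Q (L - L0) z\<close> is small.\<close>

lemma unstable_space_limit_subset:
  assumes neg: "h d1 < 0" "h d2 < 0" and "subspace_tendsto (\<lambda>p. unstable_space (L p)) E0 F"
  shows "E0 \<subseteq> K"
proof (rule subspace_tendsto_subset[OF assms(3) F subspace_kernel])
  fix x x0 assume x: "\<forall>\<^sub>F p in F. x p \<in> unstable_space (L p)" "(x \<longlongrightarrow> x0) F"
  let ?c = "cmod (m1 * m2)"
  let ?Q0 = "deflate L0 m1 m2"
  have c: "?c > 0" using m by simp
  \<comment> \<open>Within \<open>?c / 2\<close> of its limit, \<open>Q p\<close> is still bounded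
    below on \<open>K\<close>, so the preimage \<open>z\<close> is controlled by
    \<open>x p\<close>.\<close>
  have "\<forall>\<^sub>F p in F. entry_norm (Q p - ?Q0) < ?c / 2"
    using tendsto_entry_norm_diff[OF tendsto_Q] c by (intro order_tendstoD(2)) auto
  with x(1) eventually_unstable_space[OF neg]
  have "\<forall>\<^sub>F p in F. norm (L p *v x p) \<le> entry_norm (Q p) * (entry_norm (L p - L0) * (2 / ?c * norm (x p)))"
  proof eventually_elim
    case (elim p)
    then obtain z where z: "z \<in> K" "x p = Q p *v z" by auto
    have nz: "norm ((m1 * m2) *s z) = ?c * norm z"
      by (simp add: norm_vec_def norm_mult L2_set_right_distrib)
    have "norm (Q p *v z - (m1 * m2) *s z) \<le> ?c / 2 * norm z"
    proof -
      have "norm (Q p *v z - (m1 * m2) *s z) = norm ((Q p - ?Q0) *v z)"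
        using Q0_kernel[OF z(1)] by (simp add: matrix_vector_mult_diff_rdistrib)
      also have "\<dots> \<le> entry_norm (Q p - ?Q0) * norm z" by (rule norm_mult_vec_le)
      also have "\<dots> \<le> ?c / 2 * norm z" using elim by (intro mult_right_mono) auto
      finally show ?thesis .
    qed
    then have "?c / 2 * norm z \<le> norm (x p)"
      using nz z(2) norm_triangle_ineq2[of "(m1 * m2) *s z" "Q p *v z"] norm_minus_commute[of "Q p *v z"]
      by (simp add: field_simps)
    then have le: "norm z \<le> 2 / ?c * norm (x p)" using c by (simp add: field_simps)
    have nonneg: "entry_norm A \<ge> 0" for A :: "complex ^ 'n ^ 'n"
      by (simp add: entry_norm_def sum_nonneg)
    have "L p *v x p = Q p *v ((L p - L0) *v z)"
      using z by (simp add: deflate_commute matrix_vector_mult_diff_rdistrib)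
    then have "norm (L p *v x p) \<le> entry_norm (Q p) * norm ((L p - L0) *v z)"
      by (simp add: norm_mult_vec_le)
    also have "\<dots> \<le> entry_norm (Q p) * (entry_norm (L p - L0) * norm z)"
      by (intro mult_left_mono norm_mult_vec_le nonneg)
    also have "\<dots> \<le> entry_norm (Q p) * (entry_norm (L p - L0) * (2 / ?c * norm (x p)))"
      by (intro mult_left_mono le nonneg)
    finally show ?case .
  qed
  moreover have "((\<lambda>p. entry_norm (Q p) * (entry_norm (L p - L0) * (2 / ?c * norm (x p)))) \<longlongrightarrow>
      entry_norm ?Q0 * (0 * (2 / ?c * norm x0))) F"
    by (intro tendsto_intros tendsto_entry_norm tendsto_Q tendsto_entry_norm_diff L x(2))
  ultimately have "((\<lambda>p. L p *v x p) \<longlongrightarrow> 0) F"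
    by (intro Lim_null_comparison[of "\<lambda>p. L p *v x p"]) auto
  moreover have "((\<lambda>p. L p *v x p) \<longlongrightarrow> L0 *v x0) F" by (intro tendsto_intros L x(2))
  ultimately show "x0 \<in> K" using tendsto_unique[OF F] by auto
qed

lemma eventually_stable_space:
  assumes "Re m1 < 0" "Re m2 > 0"
  shows "\<forall>\<^sub>F p in F. e1 p \<noteq> 0 \<and> stable_space (L p) = vec.span {e1 p}"
proof -
  have "\<forall>\<^sub>F p in F. Re (\<mu>1 p) < 0" "\<forall>\<^sub>F p in F. Re (\<mu>2 p) > 0"
    using assms by (auto intro: order_tendstoD tendsto_Re[OF \<mu>1] tendsto_Re[OF \<mu>2])
  moreover have "\<forall>\<^sub>F p in F. e1 p \<noteq> 0" "\<forall>\<^sub>F p in F. e2 p \<noteq> 0"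
    by (intro tendsto_imp_eventually_ne[OF e1] tendsto_imp_eventually_ne[OF e2] nonzero_vectors)+
  ultimately show ?thesis
    using eventually_deflation
    by eventually_elim (simp add: deflation.stable_space_eq)
qed

lemma stable_space_tendsto:
  assumes "Re m1 < 0" "Re m2 > 0"
  shows "subspace_tendsto (\<lambda>p. stable_space (L p)) (vec.span {d1}) F"
  unfolding subspace_tendsto_def
proof (intro exI conjI allI impI)
  have basis: "indexed_basis {..<1::nat} (\<lambda>i. e) (vec.span {e})" if "e \<noteq> 0" for e :: "complex ^ 'n"
    using that by (auto simp: indexed_basis_def inj_on_def lessThan_Suc)
  show "\<forall>\<^sub>F p in F. indexed_basis {..<1::nat} (\<lambda>i. e1 p) (stable_space (L p))"
    using eventually_stable_space[OF assms]
  proof eventually_elim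
    case (elim p)
    then show ?case using basis by auto
  qed
  show "indexed_basis {..<1::nat} (\<lambda>i. d1) (vec.span {d1})" by (intro basis nonzero_vectors)
qed (rule e1)

text \<open>\<open>0\<close>, \<open>m1\<close> and \<open>m2\<close> are distinct eigenvalues of
  \<open>L0\<close>, and \<open>K\<close>, \<open>d1\<close>, \<open>d2\<close> span the space, so
  only the \<open>d1\<close> component survives.\<close>

lemma eigenspace_limit:
  assumes "L0 *v x = m1 *s x"
  shows "x \<in> vec.span {d1}"
proof -
  obtain k \<alpha> \<beta> where k: "L0 *v k = 0" "x = k + \<alpha> *s d1 + \<beta> *s d2"
    using combination_of_kernel_and_pair[OF kernel D, of x] by blast
  have eig: "L0 *v d = m *s d"
    if "(e \<longlongrightarrow> d) F" "(\<mu> \<longlongrightarrow> m) F" "\<And>p. L p *v e p = \<mu> p *s e p" for e d \<mu> m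
  proof (rule tendsto_unique[OF F])
    show "((\<lambda>p. L p *v e p) \<longlongrightarrow> L0 *v d) F" by (intro tendsto_intros L that)
    show "((\<lambda>p. L p *v e p) \<longlongrightarrow> m *s d) F" unfolding that(3) by (intro tendsto_intros that)
  qed
  have "L0 *v d1 = m1 *s d1" "L0 *v d2 = m2 *s d2"
    using eig[OF e1 \<mu>1 eig1] eig[OF e2 \<mu>2 eig2] by auto
  then have "(\<alpha> * m1) *s d1 + (\<beta> * m2) *s d2 = m1 *s k + (m1 * \<alpha>) *s d1 + (m1 * \<beta>) *s d2"
    using assms k by (simp add: matrix_vector_right_distrib vec.scale vector_smult_assoc
        vec.scale_right_distrib)
  then have *: "(\<beta> * m2) *s d2 = m1 *s k + (m1 * \<beta>) *s d2" by (simp add: mult.commute)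
  \<comment> \<open>Functionals vanishing on \<open>k\<close> leave only the \<open>d2\<close> term;
    by \<open>D\<close>, one of \<open>\<phi>1\<close> and \<open>\<phi>2\<close> is nonzero on
    \<open>d2\<close>.\<close>
  have "\<beta> * (m2 - m1) * pairing \<phi> d2 = 0" if "pairing \<phi> k = 0" for \<phi>
    using arg_cong[OF *, of "pairing \<phi>"] that by (simp add: algebra_simps)
  then have "\<beta> * (m2 - m1) * pairing \<phi>1 d2 = 0" "\<beta> * (m2 - m1) * pairing \<phi>2 d2 = 0"
    using k(1) kernel by blast+
  then have "\<beta> = 0" using D m(3) by auto
  with * have "k = 0" using m(1) by simp
  then show ?thesis using k(2) \<open>\<beta> = 0\<close> by (simp add: vec.span_scale vec.span_base)
qed

text \<open>Vectors of the stable line satisfy the eigenvalue equation for \<open>\<mu>1 p\<close>;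
  it passes to the limit and puts \<open>x0\<close> in the eigenspace of \<open>L0\<close> for
  \<open>m1\<close>.\<close>

lemma stable_space_limit_subset:
  assumes "Re m1 < 0" "Re m2 > 0" "subspace_tendsto (\<lambda>p. stable_space (L p)) E0 F"
  shows "E0 \<subseteq> vec.span {d1}"
proof (rule subspace_tendsto_subset[OF assms(3) F vec.subspace_span])
  fix x x0 assume x: "\<forall>\<^sub>F p in F. x p \<in> stable_space (L p)" "(x \<longlongrightarrow> x0) F"
  have "\<forall>\<^sub>F p in F. L p *v x p = \<mu>1 p *s x p"
    using x(1) eventually_stable_space[OF assms(1,2)]
  proof eventually_elim
    case (elim p)
    then obtain c where "x p = c *s e1 p" by (auto simp: vec.span_singleton)
    then show ?case by (simp add: vec.scale eig1 vector_smult_assoc mult.commute)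
  qed
  moreover have "((\<lambda>p. L p *v x p) \<longlongrightarrow> L0 *v x0) F" by (intro tendsto_intros L x(2))
  ultimately have "((\<lambda>p. \<mu>1 p *s x p) \<longlongrightarrow> L0 *v x0) F"
    by (rule Lim_transform_eventually[rotated])
  moreover have "((\<lambda>p. \<mu>1 p *s x p) \<longlongrightarrow> m1 *s x0) F" by (intro tendsto_intros \<mu>1 x(2))
  ultimately show "x0 \<in> vec.span {d1}" using tendsto_unique[OF F] by (intro eigenspace_limit) blast
qed

end

section \<open>The symmetric pencil of a parallel state\<close>

lemma exhaust_5:
  fixes x :: 5
  shows "x = 1 \<or> x = 2 \<or> x = 3 \<or> x = 4 \<or> x = 5"
proof (induct x)
  case (of_int z)
  then have "0 \<le> z" and "z < 5" by simp_all
  then have "z = 0 \<or> z = 1 \<or> z = 2 \<or> z = 3 \<or> z = 4" by arith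
  \<comment> \<open>The residue \<open>z = 0\<close> is the index \<open>5\<close>.\<close>
  then show ?case by auto
qed

lemma forall_5: "(\<forall>i::5. P i) \<longleftrightarrow> P 1 \<and> P 2 \<and> P 3 \<and> P 4 \<and> P 5"
  by (metis exhaust_5)

lemma UNIV_5: "UNIV = {1, 2, 3, 4, 5::5}"
  using exhaust_5 by auto

lemma sum_5: "sum f (UNIV::5 set) = f 1 + f 2 + f 3 + f 4 + f 5"
  unfolding UNIV_5 by (simp add: ac_simps)

lemma vector_5 [simp]:
  "(vector [a, b, c, d, e] :: 'a::zero ^ 5) $ 1 = a"
  "(vector [a, b, c, d, e] :: 'a::zero ^ 5) $ 2 = b"
  "(vector [a, b, c, d, e] :: 'a::zero ^ 5) $ 3 = c"
  "(vector [a, b, c, d, e] :: 'a::zero ^ 5) $ 4 = d"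
  "(vector [a, b, c, d, e] :: 'a::zero ^ 5) $ 5 = e"
  unfolding vector_def by simp_all

lemmas calc_5 = vec_eq_iff forall_5 matrix_matrix_mult_def matrix_vector_mult_def sum_5 mat_def

lemma matrix_inv_eqI:
  fixes A B :: "'a::field ^ 'n ^ 'n"
  assumes "A ** B = mat 1"
  shows "matrix_inv A = B"
proof -
  have BA: "B ** A = mat 1" using assms matrix_left_right_inverse by blast
  have "A ** matrix_inv A = mat 1 \<and> matrix_inv A ** A = mat 1"
    unfolding matrix_inv_def by (rule someI[of _ B]) (simp add: assms BA)
  then have "matrix_inv A ** (A ** B) = B" by (simp add: matrix_mul_assoc)
  then show ?thesis using assms by simp
qed

lemma map_matrix_of_real_mult:
  "map_matrix complex_of_real (A ** B) = map_matrix complex_of_real A ** map_matrix complex_of_real B"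
  by (simp add: vec_eq_iff matrix_matrix_mult_def)

definition par_state :: "real \<Rightarrow> real \<Rightarrow> real \<Rightarrow> state" where
  "par_state \<rho> v a = vector [\<rho>, \<rho> * v, 0, a, 0]"

lemma par_state_simps [simp]:
  assumes "\<rho> \<noteq> 0"
  shows "rho (par_state \<rho> v a) = \<rho>" "vel1 (par_state \<rho> v a) = v" "vel2 (par_state \<rho> v a) = 0"
    "mag1 (par_state \<rho> v a) = a" "mag2 (par_state \<rho> v a) = 0"
  using assms by (simp_all add: par_state_def rho_def vel1_def vel2_def mag1_def mag2_def)

text \<open>\<open>pencil_S\<close> is \<open>T D\<^sup>-\<^sup>1 A\<^sub>s\<close> and \<open>pencil_N\<close> is \<open>T D\<^sup>-\<^sup>1 (\<lambda> D + i \<omega> B\<^sub>s)\<close>, so that \<open>L = N S\<^sup>-\<^sup>1\<close>.\<close>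

definition pencil_S :: "real \<Rightarrow> real \<Rightarrow> real \<Rightarrow> real ^ 5 ^ 5" where
  "pencil_S \<rho> v a = vector
     [vector [v, \<rho>, 0, 0, 0],
      vector [v\<^sup>2 + 1, 2 * \<rho> * v, 0, 0, 0],
      vector [0, 0, \<rho> * v, 0, - a],
      vector [0, 0, 0, v, 0],
      vector [0, 0, - a, 0, v]]"

text \<open>The denominators \<open>v\<^sup>2 - 1\<close> and
  \<open>\<rho> * v\<^sup>2 - a\<^sup>2\<close> vanish at the sonic and at the Alfven speed.\<close>

definition pencil_S_inv :: "real \<Rightarrow> real \<Rightarrow> real \<Rightarrow> real ^ 5 ^ 5" where
  "pencil_S_inv \<rho> v a = vector
     [vector [2 * v / (v\<^sup>2 - 1), - 1 / (v\<^sup>2 - 1), 0, 0, 0],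
      vector [- (v\<^sup>2 + 1) / (\<rho> * (v\<^sup>2 - 1)), v / (\<rho> * (v\<^sup>2 - 1)), 0, 0, 0],
      vector [0, 0, v / (\<rho> * v\<^sup>2 - a\<^sup>2), 0, a / (\<rho> * v\<^sup>2 - a\<^sup>2)],
      vector [0, 0, 0, 1 / v, 0],
      vector [0, 0, a / (\<rho> * v\<^sup>2 - a\<^sup>2), 0, \<rho> * v / (\<rho> * v\<^sup>2 - a\<^sup>2)]]"

definition pencil_N :: "real \<Rightarrow> real \<Rightarrow> real \<Rightarrow> complex \<Rightarrow> complex \<Rightarrow> complex ^ 5 ^ 5" where
  "pencil_N \<rho> v a lam om = vector
     [vector [lam, 0, \<i> * om * \<rho>, 0, 0],
      vector [lam * v, lam * \<rho>, \<i> * om * v * \<rho>, 0, 0],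
      vector [\<i> * om, 0, lam * \<rho>, \<i> * om * a, 0],
      vector [0, 0, \<i> * om * a, lam, 0],
      vector [0, 0, 0, 0, lam]]"

text \<open>The locale covers both sides of a shock. \<open>v_ne_1\<close> and
  \<open>sub_alfven\<close> keep \<open>pencil_S\<close> invertible, and \<open>kernel_pos\<close>
  makes the symmetric form positive on the kernel of \<open>L(0, \<omega>)\<close>.\<close>

locale parallel_state =
  fixes \<rho> v a :: real
  assumes rho_pos: "\<rho> > 0" and v_pos: "v > 0" and v_ne_1: "v\<^sup>2 \<noteq> 1" and sub_alfven: "\<rho> * v\<^sup>2 < a\<^sup>2"
    and kernel_pos: "a\<^sup>2 * (1 - v\<^sup>2) < \<rho> * v\<^sup>2"
begin

abbreviation "U \<equiv> par_state \<rho> v a"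
abbreviation "S \<equiv> map_matrix complex_of_real (pencil_S \<rho> v a)"
abbreviation "S_inv \<equiv> map_matrix complex_of_real (pencil_S_inv \<rho> v a)"
abbreviation "N \<equiv> pencil_N \<rho> v a"

lemma nonzero: "\<rho> \<noteq> 0" "v \<noteq> 0" "v\<^sup>2 - 1 \<noteq> 0" "\<rho> * v\<^sup>2 - a\<^sup>2 \<noteq> 0" "a \<noteq> 0"
  using rho_pos v_pos v_ne_1 sub_alfven by (auto simp: mult_less_0_iff)

lemma pencil_S_right_inverse: "pencil_S \<rho> v a ** pencil_S_inv \<rho> v a = mat 1"
proof -
  define w k where "w = v\<^sup>2 - 1" and "k = \<rho> * v\<^sup>2 - a\<^sup>2"
  have "w \<noteq> 0" "k \<noteq> 0" using nonzero by (auto simp: w_def k_def)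
  then show ?thesis
    using nonzero(1,2,5) unfolding pencil_S_def pencil_S_inv_def
    by (simp add: calc_5 flip: w_def k_def)
      (auto simp: field_simps power2_eq_square; simp add: w_def k_def power2_eq_square algebra_simps)
qed

lemma S_inverse: "S ** S_inv = mat 1" "S_inv ** S = mat 1"
proof -
  show "S ** S_inv = mat 1"
    using arg_cong[OF pencil_S_right_inverse, of "map_matrix complex_of_real"]
    by (simp add: map_matrix_of_real_mult) (simp add: vec_eq_iff mat_def)
  then show "S_inv ** S = mat 1" using matrix_left_right_inverse by blast
qed

lemma S_cancel [simp]: "S *v (S_inv *v x) = x" "S_inv *v (S *v x) = x"
  by (simp_all add: matrix_vector_mul_assoc S_inverse)

lemma mat_T_invertible: "mat_T U ** matrix_inv (mat_T U) = mat 1" "matrix_inv (mat_T U) ** mat_T U = mat 1"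
proof -
  define X :: "real ^ 5 ^ 5" where "X = vector
     [vector [1, 0, 0, 0, 0], vector [- v / \<rho>, 1 / \<rho>, 0, 0, 0], vector [0, 0, 1 / \<rho>, 0, 0],
      vector [0, 0, 0, 1, 0], vector [0, 0, 0, 0, 1]]"
  have "mat_T U ** X = mat 1"
    using nonzero by (simp add: mat_T_def X_def Let_def calc_5)
  then show "mat_T U ** matrix_inv (mat_T U) = mat 1" by (simp add: matrix_inv_eqI)
  then show "matrix_inv (mat_T U) ** mat_T U = mat 1" using matrix_left_right_inverse by blast
qed

lemma matrix_inv_D: "matrix_inv (mat_D U) = vector
     [vector [\<rho>, 0, 0, 0, 0], vector [0, 1 / \<rho>, 0, 0, 0], vector [0, 0, 1 / \<rho>, 0, 0],
      vector [0, 0, 0, 1, 0], vector [0, 0, 0, 0, 1]]"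
  using nonzero by (intro matrix_inv_eqI) (simp add: mat_D_def Let_def calc_5)

lemma A_T: "mat_A U ** mat_T U = pencil_S \<rho> v a"
proof -
  have "mat_A U ** mat_T U = mat_T U ** matrix_inv (mat_D U) ** mat_A_sym U"
    by (simp add: mat_A_def matrix_mul_assoc[symmetric] mat_T_invertible)
  also have "\<dots> = pencil_S \<rho> v a"
    using nonzero unfolding matrix_inv_D
    by (simp add: mat_T_def mat_A_sym_def pencil_S_def Let_def calc_5 power2_eq_square)
  finally show ?thesis .
qed

text \<open>Written as \<open>L = ((\<lambda> + i \<omega> B) T) (A T)^-1\<close>, both factors lose
  the inverse of \<open>T\<close> and become explicit.\<close>

lemma mat_L_eq: "mat_L U lam om = N lam (complex_of_real om) ** S_inv"
proof -
  have "mat_A U ** (mat_T U ** pencil_S_inv \<rho> v a) = mat 1"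
    by (simp add: matrix_mul_assoc A_T pencil_S_right_inverse)
  from arg_cong[OF this, of "map_matrix complex_of_real"]
  have "map_matrix complex_of_real (mat_A U) ** map_matrix complex_of_real (mat_T U ** pencil_S_inv \<rho> v a) = mat 1"
    by (simp add: map_matrix_of_real_mult) (simp add: vec_eq_iff mat_def)
  then have inv: "matrix_inv (map_matrix complex_of_real (mat_A U)) = map_matrix complex_of_real (mat_T U) ** S_inv"
    by (simp add: matrix_inv_eqI map_matrix_of_real_mult)
  have BT: "mat_B U ** mat_T U = mat_T U ** matrix_inv (mat_D U) ** mat_B_sym U"
    by (simp add: mat_B_def matrix_mul_assoc[symmetric] mat_T_invertible)
  let ?c = "\<i> * complex_of_real om"
  have "map_matrix (\<lambda>z. ?c * complex_of_real z) (mat_B U) ** map_matrix complex_of_real (mat_T U)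
      = map_matrix (\<lambda>z. ?c * complex_of_real z) (mat_B U ** mat_T U)"
    by (simp add: vec_eq_iff matrix_matrix_mult_def sum_distrib_left mult.assoc)
  also have "\<dots> = map_matrix (\<lambda>z. ?c * complex_of_real z) (mat_T U ** matrix_inv (mat_D U) ** mat_B_sym U)"
    by (simp add: BT)
  finally have "(mat lam + map_matrix (\<lambda>z. ?c * complex_of_real z) (mat_B U)) ** map_matrix complex_of_real (mat_T U)
      = mat lam ** map_matrix complex_of_real (mat_T U) +
        map_matrix (\<lambda>z. ?c * complex_of_real z) (mat_T U ** matrix_inv (mat_D U) ** mat_B_sym U)"
    by (simp add: vec_eq_iff matrix_matrix_mult_def sum.distrib algebra_simps)
  also have "\<dots> = N lam (complex_of_real om)"
    using nonzero unfolding matrix_inv_D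
    by (simp add: mat_T_def mat_B_sym_def pencil_N_def Let_def calc_5)
  finally show ?thesis by (simp add: mat_L_def inv matrix_mul_assoc)
qed

lemma mat_L_mult_S: "mat_L U lam om *v (S *v y) = N lam (complex_of_real om) *v y"
  by (simp add: mat_L_eq matrix_vector_mul_assoc[symmetric])

text \<open>The Hermitian form of \<open>mat_A_sym U\<close> in the coordinates
  \<open>y\<close>.\<close>

definition form :: "complex ^ 5 \<Rightarrow> real" where
  "form x = (let y = S_inv *v x in
     v / \<rho> * (cmod (y $ 1))\<^sup>2 + 2 * Re (cnj (y $ 1) * y $ 2) + \<rho> * v * (cmod (y $ 2))\<^sup>2 +
     \<rho> * v * (cmod (y $ 3))\<^sup>2 - 2 * a * Re (cnj (y $ 3) * y $ 5) +
     v * (cmod (y $ 4))\<^sup>2 + v * (cmod (y $ 5))\<^sup>2)"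

lemma continuous_on_form: "continuous_on UNIV form"
proof -
  have "continuous_on UNIV (\<lambda>x. (S_inv *v x) $ i)" for i
    unfolding continuous_on_def by (auto intro!: tendsto_intros)
  then show ?thesis
    unfolding form_def Let_def
    by (intro continuous_on_add continuous_on_diff continuous_on_mult continuous_on_const
        continuous_on_power continuous_on_norm continuous_on_Re continuous_on_cnj)
qed

lemma form_scale: "form (c *s x) = (cmod c)\<^sup>2 * form x"
proof -
  have "cnj (c * p) * (c * q) = complex_of_real ((cmod c)\<^sup>2) * (cnj p * q)" for p q
    by (simp add: complex_norm_square[of c] del: of_real_power)
  then have re: "Re (cnj (c * p) * (c * q)) = (cmod c)\<^sup>2 * Re (cnj p * q)" for p q
    by (metis Re_complex_of_real Im_complex_of_real times_complex.simps(1) mult_zero_left diff_zero)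
  show ?thesis
    unfolding form_def Let_def vec.scale vector_smult_component norm_mult power_mult_distrib re
    by (simp only: algebra_simps)
qed

text \<open>Pairing the symmetric pencil with \<open>y\<close>: \<open>mat_B_sym U\<close> is real
  symmetric, so its form times \<open>\<i> * om\<close> is imaginary and drops out of the real
  part.\<close>

lemma eigenvalue_sign:
  assumes "x \<noteq> 0" "mat_L U lam om *v x = \<mu> *s x" "Re lam > 0"
  shows "0 < Re \<mu> * form x"
proof -
  define y where "y = S_inv *v x"
  have x: "x = S *v y" by (simp add: y_def)
  have "y \<noteq> 0" using x assms(1) by auto
  have eq: "N lam (complex_of_real om) *v y = \<mu> *s (S *v y)"
    using assms(2) unfolding x mat_L_mult_S .
  let ?y = "\<lambda>i. y $ i" and ?\<rho> = "complex_of_real \<rho>" and ?v = "complex_of_real v"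
    and ?a = "complex_of_real a" and ?om = "complex_of_real om"
  have eqs: "lam * ?y 1 + \<i> * ?om * ?\<rho> * ?y 3 = \<mu> * (?v * ?y 1 + ?\<rho> * ?y 2)"
    "lam * ?v * ?y 1 + lam * ?\<rho> * ?y 2 + \<i> * ?om * ?v * ?\<rho> * ?y 3 =
       \<mu> * ((?v\<^sup>2 + 1) * ?y 1 + 2 * ?\<rho> * ?v * ?y 2)"
    "\<i> * ?om * ?y 1 + lam * ?\<rho> * ?y 3 + \<i> * ?om * ?a * ?y 4 = \<mu> * (?\<rho> * ?v * ?y 3 - ?a * ?y 5)"
    "\<i> * ?om * ?a * ?y 3 + lam * ?y 4 = \<mu> * (?v * ?y 4)"
    "lam * ?y 5 = \<mu> * (- ?a * ?y 3 + ?v * ?y 5)"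
    using eq by (simp_all add: pencil_N_def pencil_S_def calc_5)
  \<comment> \<open>\<open>eq2\<close> and \<open>eq1\<close> restore the rows of the symmetric
    pencil: subtracting \<open>v\<close> times the first equation from the second undoes
    \<open>T\<close>, and dividing the first by \<open>\<rho>\<close> undoes the inverse of
    \<open>D\<close>.\<close>
  have eq2: "lam * ?\<rho> * ?y 2 = \<mu> * (?y 1 + ?\<rho> * ?v * ?y 2)"
  proof -
    have "lam * ?\<rho> * ?y 2 = (lam * ?v * ?y 1 + lam * ?\<rho> * ?y 2 + \<i> * ?om * ?v * ?\<rho> * ?y 3) -
        ?v * (lam * ?y 1 + \<i> * ?om * ?\<rho> * ?y 3)"
      by (simp add: algebra_simps)
    also have "\<dots> = \<mu> * (?y 1 + ?\<rho> * ?v * ?y 2)"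
      unfolding eqs(1,2) by (simp add: algebra_simps power2_eq_square)
    finally show ?thesis .
  qed
  \<comment> \<open>\<open>qD\<close> is the form of \<open>mat_D U\<close> at
    \<open>y\<close>.\<close>
  define qD where "qD = (cmod (?y 1))\<^sup>2 / \<rho> + \<rho> * (cmod (?y 2))\<^sup>2 + \<rho> * (cmod (?y 3))\<^sup>2 +
    (cmod (?y 4))\<^sup>2 + (cmod (?y 5))\<^sup>2"
  define t where "t = inverse \<rho>"
  have eq1: "complex_of_real t * lam * ?y 1 + \<i> * ?om * ?y 3 = \<mu> * (?v * complex_of_real t * ?y 1 + ?y 2)"
    using eqs(1) nonzero by (simp add: t_def field_simps)
  have real_parts: "Re (cnj u * l) = Re (cnj u * r)" if "l = r" for u l r :: complex using that by simp
  have sq: "(cmod z)\<^sup>2 = Re z * Re z + Im z * Im z" for z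
    unfolding cmod_power2 by (simp add: power2_eq_square)
  have "Re lam * qD = Re \<mu> * form x"
    using real_parts[OF eq1, of "?y 1"] real_parts[OF eq2, of "?y 2"] real_parts[OF eqs(3), of "?y 3"]
      real_parts[OF eqs(4), of "?y 4"] real_parts[OF eqs(5), of "?y 5"]
    unfolding form_def Let_def y_def[symmetric] qD_def sq
      divide_inverse t_def[symmetric]
    by (simp add: algebra_simps)
  moreover have "qD > 0"
  proof -
    have "?y 1 \<noteq> 0 \<or> ?y 2 \<noteq> 0 \<or> ?y 3 \<noteq> 0 \<or> ?y 4 \<noteq> 0 \<or> ?y 5 \<noteq> 0"
      using \<open>y \<noteq> 0\<close> by (auto simp: vec_eq_iff forall_5)
    then have "qD \<noteq> 0" using rho_pos by (auto simp: qD_def add_nonneg_eq_0_iff)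
    moreover have "qD \<ge> 0" using rho_pos by (auto simp: qD_def)
    ultimately show ?thesis by simp
  qed
  ultimately show ?thesis using assms(3) mult_pos_pos[of "Re lam" qD] by simp
qed

section \<open>The functionals \<open>y $ 3\<close> and \<open>y $ 1 + a * y $ 4\<close>, and the
  kernel at \<open>lam = 0\<close>\<close>

definition phi1 :: "complex ^ 5" where "phi1 = S_inv $ 3"
definition phi2 :: "complex ^ 5" where "phi2 = S_inv $ 1 + complex_of_real a *s S_inv $ 4"

lemma pairing_phi:
  "pairing phi1 x = (S_inv *v x) $ 3"
  "pairing phi2 x = (S_inv *v x) $ 1 + complex_of_real a * (S_inv *v x) $ 4"
  by (simp_all add: pairing_def phi1_def phi2_def matrix_vector_mult_def sum.distrib sum_distrib_left
      algebra_simps)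

text \<open>At \<open>lam = 0\<close> every row of \<open>N\<close> acts as a multiple of
  \<open>y $ 3\<close> or of \<open>y $ 1 + a * y $ 4\<close>.\<close>

lemma kernel_iff:
  assumes "om \<noteq> 0"
  shows "mat_L U 0 om *v x = 0 \<longleftrightarrow> pairing phi1 x = 0 \<and> pairing phi2 x = 0"
proof -
  define y where "y = S_inv *v x"
  have "mat_L U 0 om *v x = N 0 (complex_of_real om) *v y"
    by (simp add: mat_L_eq y_def matrix_vector_mul_assoc)
  also have "\<dots> = 0 \<longleftrightarrow> y $ 3 = 0 \<and> y $ 1 + complex_of_real a * y $ 4 = 0"
    using assms nonzero
    by (auto simp: pencil_N_def calc_5 distrib_left[symmetric] mult.assoc)
  finally show ?thesis by (simp add: pairing_phi y_def)
qed

lemma form_pos_on_kernel: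
  assumes "pairing phi1 x = 0" "pairing phi2 x = 0" "x \<noteq> 0"
  shows "form x > 0"
proof -
  define y where "y = S_inv *v x"
  have x: "x = S *v y" by (simp add: y_def)
  have y: "y $ 3 = 0" "y $ 1 = - (complex_of_real a * y $ 4)"
    using assms by (simp_all add: pairing_phi y_def eq_neg_iff_add_eq_0)
  have "y $ 2 \<noteq> 0 \<or> y $ 4 \<noteq> 0 \<or> y $ 5 \<noteq> 0"
  proof -
    have "y \<noteq> 0" using x assms(3) by auto
    then show ?thesis using y by (auto simp: vec_eq_iff forall_5)
  qed
  have sq: "(cmod z)\<^sup>2 = Re z * Re z + Im z * Im z" for z
    unfolding cmod_power2 by (simp add: power2_eq_square)
  \<comment> \<open>Completing the square in \<open>y $ 2\<close>; the coefficient left on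
    \<open>y $ 4\<close> is positive by \<open>kernel_pos\<close>.\<close>
  have form: "\<rho> * v * form x = (\<rho> * v\<^sup>2 - a\<^sup>2 * (1 - v\<^sup>2)) * (cmod (y $ 4))\<^sup>2 +
      (cmod (complex_of_real (\<rho> * v) * y $ 2 - complex_of_real a * y $ 4))\<^sup>2 + \<rho> * v\<^sup>2 * (cmod (y $ 5))\<^sup>2"
    unfolding form_def Let_def y_def[symmetric] y sq using nonzero
    by (simp add: field_simps power2_eq_square)
  have "\<rho> * v * form x > 0"
  proof (cases "y $ 4 = 0 \<and> y $ 5 = 0")
    case True
    then have "y $ 2 \<noteq> 0" using \<open>y $ 2 \<noteq> 0 \<or> y $ 4 \<noteq> 0 \<or> y $ 5 \<noteq> 0\<close> by simp
    then show ?thesis unfolding form using True nonzero by simp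
  next
    case False
    then have "0 < (\<rho> * v\<^sup>2 - a\<^sup>2 * (1 - v\<^sup>2)) * (cmod (y $ 4))\<^sup>2 + \<rho> * v\<^sup>2 * (cmod (y $ 5))\<^sup>2"
      using kernel_pos rho_pos v_pos
      by (cases "y $ 4 = 0") (auto intro!: add_pos_nonneg mult_pos_pos)
    then show ?thesis unfolding form by (smt (verit) zero_le_power2)
  qed
  then show ?thesis by (rule zero_less_mult_pos) (use rho_pos v_pos in simp)
qed

text \<open>Eliminating \<open>y\<^sub>2, y\<^sub>4, y\<^sub>5\<close> from the pencil with \<open>s = \<lambda> - \<mu> v\<close> leaves a \<open>2 \<times> 2\<close> system for \<open>y\<^sub>1, y\<^sub>3\<close>,
  whose determinant is the quartic; the eigenvector is scaled by \<open>s\<close> to avoid division.\<close>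

definition eig_y :: "complex \<Rightarrow> complex \<Rightarrow> complex \<Rightarrow> complex ^ 5" where
  "eig_y lam om \<mu> = (let s = lam - \<mu> * complex_of_real v in vector
     [- \<i> * om * complex_of_real \<rho> * s\<^sup>2,
      - \<i> * om * \<mu> * s,
      s * (s\<^sup>2 - \<mu>\<^sup>2),
      - \<i> * om * complex_of_real a * (s\<^sup>2 - \<mu>\<^sup>2),
      - \<mu> * complex_of_real a * (s\<^sup>2 - \<mu>\<^sup>2)])"

definition quartic :: "complex \<Rightarrow> complex \<Rightarrow> complex poly" where
  "quartic lam om = (let r = complex_of_real \<rho>; u = complex_of_real v; b = complex_of_real a;
       k = r * u\<^sup>2 - b\<^sup>2; w = u\<^sup>2 - 1; g = r * lam\<^sup>2 + b\<^sup>2 * om\<^sup>2 in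
     [: lam\<^sup>2 * g + om\<^sup>2 * r * lam\<^sup>2,
        - 2 * r * lam ^ 3 * u - 2 * lam * u * g - 2 * om\<^sup>2 * r * lam * u,
        lam\<^sup>2 * k + 4 * r * lam\<^sup>2 * u\<^sup>2 + w * g + om\<^sup>2 * r * u\<^sup>2,
        - 2 * lam * u * k - 2 * w * r * lam * u,
        w * k :])"

text \<open>\<open>quartic\<close> lists coefficients in powers of \<open>\<mu>\<close>; the
  right-hand side is the unexpanded determinant in terms of \<open>s\<close>.\<close>

lemma poly_quartic:
  "poly (quartic lam om) \<mu> = (let s = lam - \<mu> * complex_of_real v in
     (s\<^sup>2 - \<mu>\<^sup>2) * (complex_of_real \<rho> * s\<^sup>2 + (complex_of_real a)\<^sup>2 * (om\<^sup>2 - \<mu>\<^sup>2)) +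
     om\<^sup>2 * complex_of_real \<rho> * s\<^sup>2)"
  unfolding quartic_def Let_def by (simp add: algebra_simps power2_eq_square power3_eq_cube)

text \<open>Neither degree nor leading coefficient varies with the frequency, as
  \<open>tendsto_root\<close> requires.\<close>

lemma quartic_lead:
  "degree (quartic lam om) = 4"
  "lead_coeff (quartic lam om) = complex_of_real ((v\<^sup>2 - 1) * (\<rho> * v\<^sup>2 - a\<^sup>2))"
proof -
  have "complex_of_real ((v\<^sup>2 - 1) * (\<rho> * v\<^sup>2 - a\<^sup>2)) \<noteq> 0" using nonzero by (simp del: of_real_mult)
  then have "((complex_of_real v)\<^sup>2 - 1) * (complex_of_real \<rho> * (complex_of_real v)\<^sup>2 - (complex_of_real a)\<^sup>2) \<noteq> 0"
    by simp
  then show deg: "degree (quartic lam om) = 4" unfolding quartic_def Let_def by simp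
  show "lead_coeff (quartic lam om) = complex_of_real ((v\<^sup>2 - 1) * (\<rho> * v\<^sup>2 - a\<^sup>2))"
    unfolding deg unfolding quartic_def Let_def by (simp add: eval_nat_numeral)
qed

lemma eigenvector:
  assumes "poly (quartic lam (complex_of_real om)) \<mu> = 0"
  shows "mat_L U lam om *v (S *v eig_y lam om \<mu>) = \<mu> *s (S *v eig_y lam om \<mu>)"
proof -
  define s where "s = lam - \<mu> * complex_of_real v"
  have lam: "lam = s + \<mu> * complex_of_real v" by (simp add: s_def)
  have "(s\<^sup>2 - \<mu>\<^sup>2) * (complex_of_real \<rho> * s\<^sup>2 + (complex_of_real a)\<^sup>2 * ((complex_of_real om)\<^sup>2 - \<mu>\<^sup>2)) +
     (complex_of_real om)\<^sup>2 * complex_of_real \<rho> * s\<^sup>2 = 0"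
    using assms by (simp add: poly_quartic Let_def s_def)
  \<comment> \<open>\<open>eig_y\<close> solves four of the five equations identically; the third
    has the quartic as its residual.\<close>
  moreover have "(N lam om *v eig_y lam om \<mu> - \<mu> *s (S *v eig_y lam om \<mu>)) $ i =
      (if i = 3 then (s\<^sup>2 - \<mu>\<^sup>2) * (complex_of_real \<rho> * s\<^sup>2 + (complex_of_real a)\<^sup>2 * ((complex_of_real om)\<^sup>2 - \<mu>\<^sup>2)) +
     (complex_of_real om)\<^sup>2 * complex_of_real \<rho> * s\<^sup>2 else 0)" for i
  proof -
    have i2: "\<i> * (\<i> * z) = - z" for z by (simp flip: mult.assoc)
    show ?thesis
      using exhaust_5[of i] unfolding eig_y_def Let_def s_def[symmetric]
      by (elim disjE) (simp_all add: pencil_N_def pencil_S_def calc_5 lam algebra_simps power2_eq_square i2)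
  qed
  ultimately have "N lam om *v eig_y lam om \<mu> - \<mu> *s (S *v eig_y lam om \<mu>) = 0"
    by (simp add: vec_eq_iff)
  then show ?thesis by (simp add: mat_L_mult_S)
qed

end

section \<open>Boundary limits for a parallel state\<close>

lemma tendsto_vector_5:
  fixes a b c d e :: "'p \<Rightarrow> 'a::{zero, topological_space}"
  assumes "(a \<longlongrightarrow> a0) F" "(b \<longlongrightarrow> b0) F" "(c \<longlongrightarrow> c0) F" "(d \<longlongrightarrow> d0) F" "(e \<longlongrightarrow> e0) F"
  shows "((\<lambda>p. vector [a p, b p, c p, d p, e p] :: 'a ^ 5) \<longlongrightarrow> vector [a0, b0, c0, d0, e0]) F"
proof (rule vec_tendstoI)
  show "((\<lambda>p. (vector [a p, b p, c p, d p, e p] :: 'a ^ 5) $ i) \<longlongrightarrow> vector [a0, b0, c0, d0, e0] $ i) F" for i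
    using exhaust_5[of i] assms by (elim disjE) simp_all
qed

lemma boundary_filter_nontrivial: "at (0, om) within interior_freq \<noteq> bot"
proof -
  have "\<exists>p\<in>interior_freq. p \<noteq> (0, om) \<and> dist p (0, om) < e" if "e > 0" for e
    using that by (intro bexI[of _ "(complex_of_real (e / 2), om)"])
      (auto simp: interior_freq_def dist_prod_def)
  then have "(0, om) islimpt interior_freq" by (simp add: islimpt_approachable)
  then show ?thesis by (simp add: trivial_limit_within)
qed

text \<open>\<open>\<psi> j\<close> annihilates the span of the other vectors but not
  \<open>b j\<close>, which gives independence.\<close>

lemma indexed_basis_dual:
  assumes "\<And>i j. i \<in> I \<Longrightarrow> j \<in> I \<Longrightarrow> pairing (\<psi> i) (b j) = (if i = j then 1 else 0)"
    and "vec.subspace K" "\<And>i. i \<in> I \<Longrightarrow> b i \<in> K"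
    and "\<And>x. x \<in> K \<Longrightarrow> x = (\<Sum>i\<in>I. pairing (\<psi> i) x *s b i)"
  shows "indexed_basis I b K"
  unfolding indexed_basis_def
proof (intro conjI)
  show inj: "inj_on b I"
    using assms(1) by (intro inj_onI) (metis zero_neq_one)
  show "vec.independent (b ` I)"
    unfolding vec.dependent_def
  proof safe
    fix j assume j: "j \<in> I" "b j \<in> vec.span (b ` I - {b j})"
    have "vec.span (b ` I - {b j}) \<subseteq> {x. pairing (\<psi> j) x = 0}"
      using assms(1) j(1) by (intro vec.span_minimal) (auto simp: vec.subspace_def)
    then show False using j assms(1)[of j j] by auto
  qed
  show "vec.span (b ` I) = K"
  proof
    show "vec.span (b ` I) \<subseteq> K" using assms(2,3) by (intro vec.span_minimal) auto
    show "K \<subseteq> vec.span (b ` I)"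
    proof
      fix x assume "x \<in> K"
      then have "x = (\<Sum>i\<in>I. pairing (\<psi> i) x *s b i)" by (rule assms(4))
      also have "\<dots> \<in> vec.span (b ` I)"
        by (intro vec.span_sum vec.span_scale vec.span_base) auto
      finally show "x \<in> vec.span (b ` I)" .
    qed
  qed
qed

lemma column_basis_of_indexed_basis:
  assumes "indexed_basis {..<n::nat} b E" "CARD('k::finite) = n"
  obtains R :: "complex ^ 'k ^ 'm" where "column_basis R E"
proof -
  obtain \<pi> where \<pi>: "bij_betw \<pi> (UNIV :: 'k set) {..<n}"
    using finite_same_card_bij[of "UNIV :: 'k set" "{..<n}"] assms(2) by auto
  define R :: "complex ^ 'k ^ 'm" where "R = (\<chi> i j. b (\<pi> j) $ i)"
  have col: "column j R = b (\<pi> j)" for j by (simp add: R_def column_def vec_eq_iff)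
  have im: "range (\<lambda>j. b (\<pi> j)) = b ` {..<n}"
    using bij_betw_imp_surj_on[OF \<pi>] by (metis image_image)
  have "inj (\<lambda>j. b (\<pi> j))"
    using comp_inj_on[OF bij_betw_imp_inj_on[OF \<pi>], of b] bij_betw_imp_surj_on[OF \<pi>] assms(1)
    by (simp add: indexed_basis_def o_def)
  then have "column_basis R E"
    using assms(1) by (simp add: column_basis_def indexed_basis_def col im)
  then show ?thesis by (rule that)
qed

text \<open>\<open>\<phi>\<close> is a nonzero null vector of \<open>M\<close>.\<close>

lemma det_zero_of_pairing:
  fixes M :: "complex ^ 'n ^ 'n"
  assumes "\<phi> \<noteq> 0" "\<And>i. pairing \<phi> (M $ i) = 0"
  shows "det M = 0"
proof (rule ccontr)
  assume "det M \<noteq> 0"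
  then obtain B where B: "B ** M = mat 1" using invertible_det_nz[of M] by (auto simp: invertible_def)
  have "M *v \<phi> = 0"
    using assms(2) by (simp add: vec_eq_iff matrix_vector_mult_def pairing_def mult.commute)
  then have "(B ** M) *v \<phi> = 0" by (simp flip: matrix_vector_mul_assoc)
  then show False using B assms(1) by simp
qed

context parallel_state
begin

abbreviation "eigvec lam om \<mu> \<equiv> S *v eig_y lam (complex_of_real om) \<mu>"

lemma pairing_eigvec:
  "pairing phi1 (eigvec 0 om \<mu>) = - (\<mu> ^ 3) * complex_of_real (v * (v\<^sup>2 - 1))"
  "pairing phi2 (eigvec 0 om \<mu>) = - \<i> * om * \<mu>\<^sup>2 * complex_of_real (\<rho> * v\<^sup>2 + a\<^sup>2 * (v\<^sup>2 - 1))"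
  by (simp_all add: pairing_phi eig_y_def Let_def algebra_simps power2_eq_square power3_eq_cube)

text \<open>At \<open>lam = 0\<close> the quartic is \<open>\<mu>\<^sup>2\<close> times a quadratic
  without linear term, whose roots are \<open>\<plusminus> r\<close> by the equation for
  \<open>\<tau>\<close>; continuity of roots supplies \<open>\<mu>1\<close> and
  \<open>\<mu>2\<close> nearby.\<close>

lemma deflation_limit_at_zero:
  fixes \<tau> :: real and r :: complex
  assumes "om \<noteq> 0" and r: "r\<^sup>2 = complex_of_real \<tau>"
    and \<tau>: "\<tau> * ((v\<^sup>2 - 1) * (a\<^sup>2 - \<rho> * v\<^sup>2)) = om\<^sup>2 * ((v\<^sup>2 - 1) * a\<^sup>2 + \<rho> * v\<^sup>2)"
  obtains \<mu>1 \<mu>2 where "deflation_limit (at (0, om) within interior_freq)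
    (\<lambda>p. mat_L U (fst p) (snd p)) (mat_L U 0 om) \<mu>1 \<mu>2 (- r) r
    (\<lambda>p. eigvec (fst p) (snd p) (\<mu>1 p)) (\<lambda>p. eigvec (fst p) (snd p) (\<mu>2 p))
    (eigvec 0 om (- r)) (eigvec 0 om r) phi1 phi2 form"
proof -
  let ?F = "at (0::complex, om) within interior_freq"
  have fst: "(fst \<longlongrightarrow> 0) ?F" and snd: "(snd \<longlongrightarrow> om) ?F"
    using tendsto_fst[OF tendsto_ident_at, of "(0::complex, om)" interior_freq]
      tendsto_snd[OF tendsto_ident_at, of "(0::complex, om)" interior_freq] by simp_all
  have G: "\<rho> * v\<^sup>2 + a\<^sup>2 * (v\<^sup>2 - 1) > 0" using kernel_pos by (simp add: algebra_simps)
  then have "om\<^sup>2 * ((v\<^sup>2 - 1) * a\<^sup>2 + \<rho> * v\<^sup>2) \<noteq> 0" using assms(1) by (simp add: ac_simps)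
  then have "\<tau> \<noteq> 0" using \<tau> by auto
  then have "r \<noteq> 0" using r by auto
  have poly: "poly (quartic 0 (complex_of_real om)) m = 0" if "m\<^sup>2 = complex_of_real \<tau>" for m
  proof -
    have "poly (quartic 0 (complex_of_real om)) m =
        m\<^sup>2 * (complex_of_real (om\<^sup>2 * ((v\<^sup>2 - 1) * a\<^sup>2 + \<rho> * v\<^sup>2)) - m\<^sup>2 * complex_of_real ((v\<^sup>2 - 1) * (a\<^sup>2 - \<rho> * v\<^sup>2)))"
      by (simp add: poly_quartic Let_def algebra_simps power2_eq_square)
    also have "\<dots> = m\<^sup>2 * (complex_of_real (om\<^sup>2 * ((v\<^sup>2 - 1) * a\<^sup>2 + \<rho> * v\<^sup>2)) -
        complex_of_real (\<tau> * ((v\<^sup>2 - 1) * (a\<^sup>2 - \<rho> * v\<^sup>2))))"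
      by (simp only: that of_real_mult)
    also have "\<dots> = 0" by (simp only: \<tau>) simp
    finally show ?thesis .
  qed
  have root: "\<exists>\<mu>. (\<forall>p. poly (quartic (fst p) (complex_of_real (snd p))) (\<mu> p) = 0) \<and> (\<mu> \<longlongrightarrow> m) ?F"
    if "m\<^sup>2 = complex_of_real \<tau>" for m
  proof -
    have "((\<lambda>p. poly (quartic (fst p) (complex_of_real (snd p))) m) \<longlongrightarrow> poly (quartic 0 (complex_of_real om)) m) ?F"
      unfolding poly_quartic Let_def by (intro tendsto_intros fst snd)
    then have lim0: "((\<lambda>p. poly (quartic (fst p) (complex_of_real (snd p))) m) \<longlongrightarrow> 0) ?F"
      by (simp only: poly[OF that])
    show ?thesis
      by (rule tendsto_root[OF quartic_lead(1) _ quartic_lead(2) lim0]) (simp, blast)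
  qed
  obtain \<mu>1 where \<mu>1: "\<And>p. poly (quartic (fst p) (complex_of_real (snd p))) (\<mu>1 p) = 0" "(\<mu>1 \<longlongrightarrow> - r) ?F"
    using root[of "- r"] r unfolding power2_minus by blast
  obtain \<mu>2 where \<mu>2: "\<And>p. poly (quartic (fst p) (complex_of_real (snd p))) (\<mu>2 p) = 0" "(\<mu>2 \<longlongrightarrow> r) ?F"
    using root[of r] r by blast
  have vec: "((\<lambda>p. eigvec (fst p) (snd p) (\<mu> p)) \<longlongrightarrow> eigvec 0 om m) ?F" if "(\<mu> \<longlongrightarrow> m) ?F" for \<mu> m
    unfolding eig_y_def Let_def
    by (intro tendsto_mat_mult_vec tendsto_const tendsto_vector_5 tendsto_intros fst snd that)
  have "deflation_limit ?F (\<lambda>p. mat_L U (fst p) (snd p)) (mat_L U 0 om) \<mu>1 \<mu>2 (- r) r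
    (\<lambda>p. eigvec (fst p) (snd p) (\<mu>1 p)) (\<lambda>p. eigvec (fst p) (snd p) (\<mu>2 p))
    (eigvec 0 om (- r)) (eigvec 0 om r) phi1 phi2 form"
  proof
    show "?F \<noteq> bot" by (rule boundary_filter_nontrivial)
    show "((\<lambda>p. mat_L U (fst p) (snd p)) \<longlongrightarrow> mat_L U 0 om) ?F"
      unfolding mat_L_eq pencil_N_def
      by (intro tendsto_mat_mult tendsto_const tendsto_vector_5 tendsto_intros fst snd)
    \<comment> \<open>On \<open>eigvec 0 om\<close>, \<open>phi1\<close> is odd and
      \<open>phi2\<close> even in the eigenvalue, so \<open>- r\<close> and \<open>r\<close> give a
      nonzero determinant.\<close>
    show "pairing phi1 (eigvec 0 om (- r)) * pairing phi2 (eigvec 0 om r) \<noteq>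
        pairing phi1 (eigvec 0 om r) * pairing phi2 (eigvec 0 om (- r))"
    proof -
      define u g where "u = complex_of_real (v * (v\<^sup>2 - 1))" and "g = complex_of_real (\<rho> * v\<^sup>2 + a\<^sup>2 * (v\<^sup>2 - 1))"
      have "u \<noteq> 0" "g \<noteq> 0" using nonzero G unfolding u_def g_def of_real_eq_0_iff by auto
      then have "r ^ 3 * u * (- \<i> * om * r\<^sup>2 * g) \<noteq> - (r ^ 3) * u * (- \<i> * om * r\<^sup>2 * g)"
        using \<open>r \<noteq> 0\<close> assms(1) by simp
      then show ?thesis unfolding pairing_eigvec u_def g_def by simp
    qed
    show "\<forall>\<^sub>F p in ?F. \<forall>x \<mu>. x \<noteq> 0 \<longrightarrow> mat_L U (fst p) (snd p) *v x = \<mu> *s x \<longrightarrow> 0 < Re \<mu> * form x"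
      unfolding eventually_at_filter
      by (intro always_eventually) (auto simp: interior_freq_def intro: eigenvalue_sign)
    show "mat_L U 0 om *v x = 0 \<longleftrightarrow> pairing phi1 x = 0 \<and> pairing phi2 x = 0" for x
      by (rule kernel_iff[OF assms(1)])
    then show "form z > 0" if "mat_L U 0 om *v z = 0" "z \<noteq> 0" for z
      using that form_pos_on_kernel by blast
  qed (use \<open>r \<noteq> 0\<close> \<mu>1 \<mu>2 vec continuous_on_form form_scale eigenvector in auto)
  then show ?thesis by (rule that)
qed

text \<open>For supersonic \<open>v\<close> the limit eigenvalues are real and of opposite sign; the
  obtained \<open>r\<close> is the negative one. The last claim covers every limit space that
  \<open>subspace_tendsto\<close> admits.\<close>

lemma stable_limits:
  assumes "v\<^sup>2 > 1" "om \<noteq> 0"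
  obtains r where
    "eigvec 0 om r \<noteq> 0"
    "subspace_tendsto (\<lambda>(lam, om). stable_space (mat_L U lam om)) (vec.span {eigvec 0 om r})
       (at (0, om) within interior_freq)"
    "\<And>E0. subspace_tendsto (\<lambda>(lam, om). stable_space (mat_L U lam om)) E0
       (at (0, om) within interior_freq) \<Longrightarrow> E0 \<subseteq> vec.span {eigvec 0 om r}"
proof -
  define \<tau> where "\<tau> = om\<^sup>2 * ((v\<^sup>2 - 1) * a\<^sup>2 + \<rho> * v\<^sup>2) / ((v\<^sup>2 - 1) * (a\<^sup>2 - \<rho> * v\<^sup>2))"
  have den: "(v\<^sup>2 - 1) * (a\<^sup>2 - \<rho> * v\<^sup>2) > 0" using assms(1) sub_alfven by simp
  have "\<tau> > 0" unfolding \<tau>_def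
    using assms sub_alfven rho_pos v_pos by (intro divide_pos_pos mult_pos_pos add_nonneg_pos) auto
  define r where "r = complex_of_real (sqrt \<tau>)"
  have r2: "r\<^sup>2 = complex_of_real \<tau>" using \<open>\<tau> > 0\<close> by (simp add: r_def flip: of_real_power)
  have "\<tau> * ((v\<^sup>2 - 1) * (a\<^sup>2 - \<rho> * v\<^sup>2)) = om\<^sup>2 * ((v\<^sup>2 - 1) * a\<^sup>2 + \<rho> * v\<^sup>2)"
    using den unfolding \<tau>_def by (metis less_irrefl nonzero_eq_divide_eq)
  from deflation_limit_at_zero[OF assms(2) r2 this] obtain \<mu>1 \<mu>2 where
    lim: "deflation_limit (at (0, om) within interior_freq)
    (\<lambda>p. mat_L U (fst p) (snd p)) (mat_L U 0 om) \<mu>1 \<mu>2 (- r) r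
    (\<lambda>p. eigvec (fst p) (snd p) (\<mu>1 p)) (\<lambda>p. eigvec (fst p) (snd p) (\<mu>2 p))
    (eigvec 0 om (- r)) (eigvec 0 om r) phi1 phi2 form" by blast
  have re: "Re (- r) < 0" "Re r > 0" using \<open>\<tau> > 0\<close> by (simp_all add: r_def)
  show ?thesis
  proof (rule that[of "- r"])
    show "eigvec 0 om (- r) \<noteq> 0" by (rule deflation_limit.nonzero_vectors(1)[OF lim])
  qed (use deflation_limit.stable_space_tendsto[OF lim re] deflation_limit.stable_space_limit_subset[OF lim re]
      in \<open>simp_all add: case_prod_unfold\<close>)
qed

text \<open>For imaginary \<open>m\<close> the vector \<open>y\<close> is \<open>\<i>\<close> times
  a real vector. The relation for \<open>t\<close> leaves \<open>t ^ 4 * v * (v\<^sup>2 - 1)\<close>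
  times a factor that is positive by \<open>kernel_pos\<close>, and \<open>v\<^sup>2 < 1\<close>
  makes the product negative.\<close>

lemma form_eigvec_neg:
  assumes "v\<^sup>2 < 1" "om \<noteq> 0" "m = \<i> * complex_of_real t" "t \<noteq> 0"
    and t: "- (t\<^sup>2) * ((v\<^sup>2 - 1) * (a\<^sup>2 - \<rho> * v\<^sup>2)) = om\<^sup>2 * ((v\<^sup>2 - 1) * a\<^sup>2 + \<rho> * v\<^sup>2)"
  shows "form (eigvec 0 om m) < 0"
proof -
  define w where "w = v\<^sup>2 - 1"
  have y: "eig_y 0 (complex_of_real om) m = vector
     [\<i> * complex_of_real (om * \<rho> * t\<^sup>2 * v\<^sup>2), \<i> * complex_of_real (- om * t\<^sup>2 * v),
      \<i> * complex_of_real (t ^ 3 * v * w), \<i> * complex_of_real (om * a * t\<^sup>2 * w),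
      \<i> * complex_of_real (a * t ^ 3 * w)]"
  proof -
    have i2: "\<i> * (\<i> * z) = - z" for z by (simp flip: mult.assoc)
    show ?thesis
      unfolding eig_y_def Let_def w_def assms(3)
      by (simp add: vec_eq_iff forall_5 algebra_simps power2_eq_square power3_eq_cube i2)
  qed
  have im: "(cmod (\<i> * complex_of_real z))\<^sup>2 = z\<^sup>2" for z by (simp add: norm_mult)
  have re: "Re (cnj (\<i> * complex_of_real z) * (\<i> * complex_of_real z')) = z * z'" for z z' by simp
  have "form (eigvec 0 om m) = t ^ 4 * v * w * (om\<^sup>2 * \<rho> * v\<^sup>2 + t\<^sup>2 * w * (\<rho> * v\<^sup>2 - a\<^sup>2) + om\<^sup>2 * a\<^sup>2 * w)"
  proof -
    have "v / \<rho> * (om * \<rho> * t\<^sup>2 * v\<^sup>2)\<^sup>2 = \<rho> * v * (om * t\<^sup>2 * v\<^sup>2)\<^sup>2"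
      using nonzero by (simp add: power2_eq_square)
    then show ?thesis
      unfolding form_def Let_def S_cancel y vector_5 im re
      by (simp add: w_def algebra_simps power2_eq_square eval_nat_numeral)
  qed
  also have "\<dots> = t ^ 4 * v * w * (2 * om\<^sup>2 * (\<rho> * v\<^sup>2 - a\<^sup>2 * (1 - v\<^sup>2)))"
  proof -
    have bracket: "t\<^sup>2 * w * (\<rho> * v\<^sup>2 - a\<^sup>2) = om\<^sup>2 * (w * a\<^sup>2 + \<rho> * v\<^sup>2)"
      using t by (simp add: w_def algebra_simps)
    show ?thesis unfolding bracket by (simp add: w_def algebra_simps)
  qed
  also have "\<dots> < 0"
    using kernel_pos assms v_pos
    by (intro mult_neg_pos mult_pos_neg mult_pos_pos) (auto simp: w_def zero_less_power_eq)
  finally show ?thesis .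
qed

lemma kernel_basis:
  assumes "om \<noteq> 0"
  obtains b where "indexed_basis {..<3::nat} b {x. mat_L U 0 om *v x = 0}"
proof -
  \<comment> \<open>In the coordinates \<open>y\<close> of the kernel, \<open>y $ 2\<close>,
    \<open>y $ 5\<close> and \<open>y $ 4\<close> are free, with \<open>y $ 3 = 0\<close> and
    \<open>y $ 1 = - a * y $ 4\<close>; \<open>\<psi>\<close> reads off the free ones in this
    order.\<close>
  define b where "b i = S *v ([vector [0, 1, 0, 0, 0], vector [0, 0, 0, 0, 1], vector [- complex_of_real a, 0, 0, 1, 0]] ! i)"
    for i :: nat
  define \<psi> where "\<psi> i = [S_inv $ 2, S_inv $ 5, S_inv $ 4] ! i" for i :: nat
  have row: "pairing (S_inv $ i) x = (S_inv *v x) $ i" for i x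
    by (simp add: pairing_def matrix_vector_mult_def)
  have three: "{..<3::nat} = {0, 1, 2}" by auto
  have "indexed_basis {..<3} b {x. mat_L U 0 om *v x = 0}"
  proof (rule indexed_basis_dual[where \<psi> = \<psi>])
    show "pairing (\<psi> i) (b j) = (if i = j then 1 else 0)" if "i \<in> {..<3}" "j \<in> {..<3}" for i j
      using that unfolding three by (auto simp: \<psi>_def b_def row)
    show "b i \<in> {x. mat_L U 0 om *v x = 0}" if "i \<in> {..<3}" for i
      using that unfolding three by (auto simp: b_def kernel_iff[OF assms] pairing_phi)
    show "vec.subspace {x. mat_L U 0 om *v x = 0}" by (rule subspace_kernel)
    fix x assume "x \<in> {x. mat_L U 0 om *v x = 0}"
    define y where "y = S_inv *v x"
    have "y $ 3 = 0" "y $ 1 = - (complex_of_real a * y $ 4)"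
      using \<open>x \<in> _\<close> by (simp_all add: kernel_iff[OF assms] pairing_phi y_def eq_neg_iff_add_eq_0)
    then have y: "y = y $ 2 *s vector [0, 1, 0, 0, 0] + y $ 5 *s vector [0, 0, 0, 0, 1] +
        y $ 4 *s vector [- complex_of_real a, 0, 0, 1, 0]"
      by (simp add: vec_eq_iff forall_5)
    have "x = S *v y" by (simp add: y_def)
    also have "\<dots> = y $ 2 *s b 0 + y $ 5 *s b 1 + y $ 4 *s b 2"
      by (subst y) (simp add: b_def matrix_vector_right_distrib vec.scale)
    also have "\<dots> = pairing (\<psi> 0) x *s b 0 + pairing (\<psi> 1) x *s b 1 + pairing (\<psi> 2) x *s b 2"
      by (simp add: \<psi>_def row y_def)
    also have "\<dots> = (\<Sum>i\<in>{..<3}. pairing (\<psi> i) x *s b i)"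
      unfolding three by (simp add: add.assoc)
    finally show "x = (\<Sum>i\<in>{..<3}. pairing (\<psi> i) x *s b i)" .
  qed
  then show ?thesis by (rule that)
qed

text \<open>For subsonic \<open>v\<close> the limit eigenvalues are imaginary, but
  \<open>form\<close> is negative on both limit eigenvectors, so the approximating eigenvalues are
  stable and only the deflated image of the kernel is unstable.\<close>

lemma unstable_limits:
  assumes "v\<^sup>2 < 1" "om \<noteq> 0"
  defines "K \<equiv> {x. mat_L U 0 om *v x = 0}"
  shows "subspace_tendsto (\<lambda>(lam, om). unstable_space (mat_L U lam om)) K
       (at (0, om) within interior_freq)"
    and "subspace_tendsto (\<lambda>(lam, om). unstable_space (mat_L U lam om)) E0
       (at (0, om) within interior_freq) \<Longrightarrow> E0 \<subseteq> K"
proof -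
  define t where "t = sqrt (om\<^sup>2 * ((v\<^sup>2 - 1) * a\<^sup>2 + \<rho> * v\<^sup>2) / ((1 - v\<^sup>2) * (a\<^sup>2 - \<rho> * v\<^sup>2)))"
  have den: "(1 - v\<^sup>2) * (a\<^sup>2 - \<rho> * v\<^sup>2) > 0" using assms(1) sub_alfven by simp
  have num: "om\<^sup>2 * ((v\<^sup>2 - 1) * a\<^sup>2 + \<rho> * v\<^sup>2) > 0"
    using assms(2) kernel_pos by (intro mult_pos_pos) (auto simp: algebra_simps)
  have "t > 0" unfolding t_def using num den by simp
  have t2: "t\<^sup>2 = om\<^sup>2 * ((v\<^sup>2 - 1) * a\<^sup>2 + \<rho> * v\<^sup>2) / ((1 - v\<^sup>2) * (a\<^sup>2 - \<rho> * v\<^sup>2))"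
    unfolding t_def using num den by (simp add: less_imp_le)
  have \<tau>: "- (t\<^sup>2) * ((v\<^sup>2 - 1) * (a\<^sup>2 - \<rho> * v\<^sup>2)) = om\<^sup>2 * ((v\<^sup>2 - 1) * a\<^sup>2 + \<rho> * v\<^sup>2)"
  proof -
    have "- (t\<^sup>2) * ((v\<^sup>2 - 1) * (a\<^sup>2 - \<rho> * v\<^sup>2)) = t\<^sup>2 * ((1 - v\<^sup>2) * (a\<^sup>2 - \<rho> * v\<^sup>2))"
      by (simp add: algebra_simps)
    also have "\<dots> = om\<^sup>2 * ((v\<^sup>2 - 1) * a\<^sup>2 + \<rho> * v\<^sup>2)"
      using den unfolding t2 by (metis less_irrefl nonzero_eq_divide_eq)
    finally show ?thesis .
  qed
  define r where "r = \<i> * complex_of_real t"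
  have r2: "r\<^sup>2 = complex_of_real (- (t\<^sup>2))" by (simp add: r_def power_mult_distrib)
  from deflation_limit_at_zero[OF assms(2) r2 \<tau>] obtain \<mu>1 \<mu>2 where
    lim: "deflation_limit (at (0, om) within interior_freq)
    (\<lambda>p. mat_L U (fst p) (snd p)) (mat_L U 0 om) \<mu>1 \<mu>2 (- r) r
    (\<lambda>p. eigvec (fst p) (snd p) (\<mu>1 p)) (\<lambda>p. eigvec (fst p) (snd p) (\<mu>2 p))
    (eigvec 0 om (- r)) (eigvec 0 om r) phi1 phi2 form" by blast
  have neg: "form (eigvec 0 om (- r)) < 0" "form (eigvec 0 om r) < 0"
    using form_eigvec_neg[OF assms(1,2), of "- r" "- t"] form_eigvec_neg[OF assms(1,2), of r t]
      \<open>t > 0\<close> \<tau> unfolding power2_minus by (simp_all add: r_def)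
  obtain b where b: "indexed_basis {..<3::nat} b {x. mat_L U 0 om *v x = 0}"
    using kernel_basis[OF assms(2)] by blast
  show "subspace_tendsto (\<lambda>(lam, om). unstable_space (mat_L U lam om)) K (at (0, om) within interior_freq)"
    using deflation_limit.unstable_space_tendsto_kernel[OF lim neg b] by (simp add: case_prod_unfold K_def)
  show "E0 \<subseteq> K" if "subspace_tendsto (\<lambda>(lam, om). unstable_space (mat_L U lam om)) E0
       (at (0, om) within interior_freq)"
    using deflation_limit.unstable_space_limit_subset[OF lim neg] that by (simp add: case_prod_unfold K_def)
qed

end

section \<open>Parallel shocks\<close>

lemma state_eq_par_state:
  assumes "rho U \<noteq> 0" "vel2 U = 0" "mag2 U = 0"
  shows "U = par_state (rho U) (vel1 U) (mag1 U)"
proof -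
  have "U $ 5 = 0" using assms(3) by (simp add: mag2_def)
  then show ?thesis
    using assms(1,2) unfolding vec_eq_iff forall_5
    by (simp add: par_state_def rho_def vel1_def vel2_def mag1_def)
qed

text \<open>Eliminating \<open>b\<close> gives \<open>(m * v - a\<^sup>2) * w = 0\<close>, and the
  first factor is negative for sub-Alfvenic flow.\<close>

lemma transverse_zero:
  fixes a m v w b :: real
  assumes "m * w = a * b" "v * b = a * w" "m * v < a\<^sup>2" "a \<noteq> 0"
  shows "w = 0 \<and> b = 0"
proof -
  have "(m * v) * w = v * (m * w)" by simp
  also have "\<dots> = a * (v * b)" by (simp add: assms(1))
  also have "\<dots> = a\<^sup>2 * w" by (simp add: assms(2) power2_eq_square)
  finally have "w = 0" using assms(3) by simp
  then show ?thesis using assms(1,4) by simp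
qed

text \<open>\<open>m\<close> is the mass flux, equal to the velocity in front because the density
  there is 1. Without transverse components the Rankine-Hugoniot conditions become
  \<open>(m\<^sup>2 - R) * (R - 1) = 0\<close>, and the Lax condition excludes
  \<open>R = 1\<close>.\<close>

lemma slow_parallel_shock_states:
  assumes "slow_parallel_shock a Um Up" "rho Um = 1"
  obtains m where "m > 0" "m\<^sup>2 > 1" "m\<^sup>2 < a\<^sup>2" "rho Up = m\<^sup>2"
    "Um = par_state 1 m a" "Up = par_state (m\<^sup>2) (1 / m) a"
proof -
  define m R where "m = vel1 Um" and "R = rho Up"
  note shock = assms(1)[unfolded slow_parallel_shock_def normalized_shock_def planar_shock_def
      shock_m_def shock_c_def shock_d_def]
  have "R > 0" "m > 0" "mag1 Um = a" "mag1 Up = a" "flux_F Um = flux_F Up"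
    using shock assms(2) by (auto simp: m_def R_def)
  have a: "m\<^sup>2 < a\<^sup>2" "R * (vel1 Up)\<^sup>2 < m\<^sup>2" using shock assms(2) by (auto simp: m_def R_def)
  then have "a \<noteq> 0" using zero_le_power2[of m] by auto
  have comp: "flux_F Um $ i = flux_F Up $ i" for i using \<open>flux_F Um = flux_F Up\<close> by simp
  note flux = flux_F_def Let_def \<open>mag1 Um = a\<close> \<open>mag1 Up = a\<close> assms(2) diff_divide_distrib
    m_def[symmetric] R_def[symmetric]
  have F1: "m = R * vel1 Up" using comp[of 1] by (simp add: flux)
  have F2: "m\<^sup>2 + 1 + (mag2 Um)\<^sup>2 / 2 = R * (vel1 Up)\<^sup>2 + R + (mag2 Up)\<^sup>2 / 2"
    using comp[of 2] by (simp add: flux)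
  have F3: "m * vel2 Um - a * mag2 Um = R * vel1 Up * vel2 Up - a * mag2 Up"
    using comp[of 3] by (simp add: flux)
  have F5: "mag2 Um * m - vel2 Um * a = mag2 Up * vel1 Up - vel2 Up * a"
    using comp[of 5] by (simp add: flux)
  have minus: "vel2 Um = 0 \<and> mag2 Um = 0"
    using shock assms(2) a(1) \<open>a \<noteq> 0\<close> \<open>mag1 Um = a\<close>
    by (intro transverse_zero[of m _ a _ m]) (auto simp: m_def power2_eq_square)
  \<comment> \<open>Components 3 and 5 of the flux carry the vanishing constants \<open>d\<close>
    and \<open>c\<close> over to the state behind the shock.\<close>
  have plus: "vel2 Up = 0 \<and> mag2 Up = 0"
  proof (rule transverse_zero[of m _ a _ "vel1 Up"])
    show "m * vel2 Up = a * mag2 Up" "vel1 Up * mag2 Up = a * vel2 Up"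
      using F1 F3 F5 minus by (simp_all add: algebra_simps)
    show "m * vel1 Up < a\<^sup>2" using F1 a by (simp add: power2_eq_square)
  qed fact
  have v: "vel1 Up = m / R" using F1 \<open>R > 0\<close> by simp
  have "m\<^sup>2 + 1 = m\<^sup>2 / R + R"
    using F2 minus plus \<open>R > 0\<close> by (simp add: v power2_eq_square)
  then have "(m\<^sup>2 - R) * (R - 1) = 0" using \<open>R > 0\<close> by (simp add: field_simps)
  moreover have "R > 1"
  proof -
    have "m\<^sup>2 / R < m\<^sup>2" using a(2) \<open>R > 0\<close> by (simp add: v power2_eq_square)
    then show ?thesis using \<open>R > 0\<close> \<open>m > 0\<close> by (simp add: field_simps)
  qed
  ultimately have "R = m\<^sup>2" by simp
  show ?thesis
  proof (rule that[of m])
    show "m\<^sup>2 > 1" "rho Up = m\<^sup>2" using \<open>R > 1\<close> \<open>R = m\<^sup>2\<close> by (simp_all add: R_def)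
    show "Um = par_state 1 m a"
      using state_eq_par_state[of Um] minus assms(2) \<open>mag1 Um = a\<close> by (simp add: m_def)
    show "Up = par_state (m\<^sup>2) (1 / m) a"
      using state_eq_par_state[of Up] plus \<open>mag1 Up = a\<close> \<open>R > 0\<close> \<open>m > 0\<close> \<open>R = m\<^sup>2\<close> v
      by (simp add: R_def power2_eq_square)
  qed fact+
qed

text \<open>\<open>plus.phi2\<close> annihilates all five columns for every admissible choice of
  bases.\<close>

lemma lopatinski_values_zero:
  fixes m a om :: real
  assumes m: "m > 0" "m\<^sup>2 > 1" "m\<^sup>2 < a\<^sup>2" "m\<^sup>2 * (a\<^sup>2 + 1) = a\<^sup>2 + 2" and "om \<noteq> 0"
  shows "lopatinski_values (par_state 1 m a) (par_state (m\<^sup>2) (1 / m) a) 0 om = {0}"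
proof -
  have "a\<^sup>2 * (1 - m\<^sup>2) \<le> 0" using m(2) by (simp add: mult_nonneg_nonpos)
  then have "a\<^sup>2 * (1 - m\<^sup>2) < 1 * m\<^sup>2" using m(2) by linarith
  then interpret minus: parallel_state 1 m a
    using m by unfold_locales auto
  \<comment> \<open>The prescribed density gives
    \<open>a\<^sup>2 * m\<^sup>2 - a\<^sup>2 = 2 - m\<^sup>2\<close>, which is below
    \<open>m\<^sup>2\<close> as \<open>m\<^sup>2 > 1\<close>.\<close>
  have "a\<^sup>2 * (1 - (1 / m)\<^sup>2) < m\<^sup>2 * (1 / m)\<^sup>2"
  proof -
    have "a\<^sup>2 * m\<^sup>2 - a\<^sup>2 < m\<^sup>2" using m(2,4) by (simp add: algebra_simps)
    then show ?thesis using m(1) by (simp add: field_simps)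
  qed
  then interpret plus: parallel_state "m\<^sup>2" "1 / m" a
    using m by unfold_locales (auto simp: power_divide)
  let ?F = "at (0::complex, om) within interior_freq"
  let ?Um = "par_state 1 m a" and ?Up = "par_state (m\<^sup>2) (1 / m) a"
  obtain r where r: "minus.eigvec 0 om r \<noteq> 0"
    "subspace_tendsto (\<lambda>(lam, om). stable_space (mat_L ?Um lam om)) (vec.span {minus.eigvec 0 om r}) ?F"
    "\<And>E0. subspace_tendsto (\<lambda>(lam, om). stable_space (mat_L ?Um lam om)) E0 ?F \<Longrightarrow>
       E0 \<subseteq> vec.span {minus.eigvec 0 om r}"
    using minus.stable_limits[OF m(2) assms(5)] by blast
  define K where "K = {x. mat_L ?Up 0 om *v x = 0}"
  have "(1 / m)\<^sup>2 < 1" using m by (simp add: power_divide)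
  note unstable = plus.unstable_limits[OF this assms(5), folded K_def]
  have freq: "(0, om) \<notin> interior_freq" "(0, om) \<in> boundary_freq"
    using assms(5) by (simp_all add: interior_freq_def boundary_freq_def)
  \<comment> \<open>\<open>p\<close> and \<open>q\<close> are the nonzero entries in the first row
    of the inverse pencil behind the shock.\<close>
  define p q where "p = 2 * m / (1 - m\<^sup>2)" and "q = - (m\<^sup>2) / (1 - m\<^sup>2)"
  have pq: "p * (m\<^sup>2 - 1) = - 2 * m" "q * (m\<^sup>2 - 1) = m\<^sup>2"
    using m(2) by (simp_all add: p_def q_def field_simps)
  have phi2: "plus.phi2 = vector [complex_of_real p, complex_of_real q, 0, complex_of_real (a * m), 0]"
  proof -
    have "(1 / m)\<^sup>2 - 1 = (1 - m\<^sup>2) / m\<^sup>2" using m(1) by (simp add: field_simps)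
    then have "2 * (1 / m) / ((1 / m)\<^sup>2 - 1) = p" "- 1 / ((1 / m)\<^sup>2 - 1) = q"
      using m(1) by (simp_all add: p_def q_def power2_eq_square)
    then have "pencil_S_inv (m\<^sup>2) (1 / m) a $ 1 = vector [p, q, 0, 0, 0]"
      unfolding pencil_S_inv_def by simp
    then show ?thesis
      by (simp add: plus.phi2_def vec_eq_iff forall_5) (simp add: pencil_S_inv_def)
  qed
  have "complex_of_real (a * m) \<noteq> 0" using m(1) minus.nonzero by simp
  then have "plus.phi2 \<noteq> 0" by (auto simp: phi2 vec_eq_iff forall_5)
  have phi_eig: "pairing plus.phi2 (minus.eigvec 0 om r) = 0"
  proof -
    \<comment> \<open>The bracket reduces to \<open>m\<close> times
      \<open>m\<^sup>2 * (a\<^sup>2 + 1) - (a\<^sup>2 + 2)\<close>, which the prescribed density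
      makes 0.\<close>
    have "pairing plus.phi2 (minus.eigvec 0 om r) = - \<i> * om * r\<^sup>2 * m *
        complex_of_real (p * (m\<^sup>2 - 1) + m * (q * (m\<^sup>2 - 1)) + a\<^sup>2 * m * (m\<^sup>2 - 1))"
      unfolding phi2 pairing_def minus.eig_y_def Let_def pencil_S_def
      by (simp add: sum_5 matrix_vector_mult_def algebra_simps power2_eq_square power3_eq_cube)
    also have "p * (m\<^sup>2 - 1) + m * (q * (m\<^sup>2 - 1)) + a\<^sup>2 * m * (m\<^sup>2 - 1) = m * (m\<^sup>2 * (a\<^sup>2 + 1) - (a\<^sup>2 + 2))"
      unfolding pq by (simp add: algebra_simps power2_eq_square)
    also have "\<dots> = 0" by (simp add: m(4))
    finally show ?thesis by simp
  qed
  \<comment> \<open>At \<open>lam = 0\<close> only the third entry of the jump is nonzero, and there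
    \<open>plus.phi2\<close> has entry 0.\<close>
  have phi_J: "pairing plus.phi2 (jump_J ?Um ?Up 0 om) = 0"
    using m(1) by (simp add: phi2 pairing_def sum_5 jump_J_def cvec_def flux_G_def Let_def)
  have zero: "lopatinski_det Rm (jump_J ?Um ?Up 0 om) Rp = 0"
    if bases: "minus_basis ?Um 0 om Rm" "plus_basis ?Up 0 om Rp" for Rm Rp
  proof -
    obtain Em where Em: "subspace_tendsto (\<lambda>(lam, om). stable_space (mat_L ?Um lam om)) Em ?F"
        "column_basis Rm Em"
      using bases(1) freq by (auto simp: minus_basis_def extended_basis_def)
    obtain Ep where Ep: "subspace_tendsto (\<lambda>(lam, om). unstable_space (mat_L ?Up lam om)) Ep ?F"
        "column_basis Rp Ep"
      using bases(2) freq by (auto simp: plus_basis_def extended_basis_def)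
    have "column 1 Rm \<in> vec.span {minus.eigvec 0 om r}"
      using r(3)[OF Em(1)] Em(2) vec.span_base[of "column 1 Rm" "range (\<lambda>j. column j Rm)"]
      by (auto simp: column_basis_def indexed_basis_def)
    then have 1: "pairing plus.phi2 (column 1 Rm) = 0"
      using phi_eig by (auto simp: vec.span_singleton)
    have "column j Rp \<in> K" for j
      using unstable(2)[OF Ep(1)] Ep(2) vec.span_base[of "column j Rp" "range (\<lambda>j. column j Rp)"]
      by (auto simp: column_basis_def indexed_basis_def)
    then have 2: "pairing plus.phi2 (column j Rp) = 0" for j
      using plus.kernel_iff[OF assms(5)] by (simp add: K_def)
    have "pairing plus.phi2 ((vector [column 1 Rm, jump_J ?Um ?Up 0 om, column 1 Rp, column 2 Rp,
        column 3 Rp] :: complex ^ 5 ^ 5) $ i) = 0" for i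
      using exhaust_5[of i] 1 2 phi_J by (elim disjE) (simp_all only: vector_5)
    then have "det (vector [column 1 Rm, jump_J ?Um ?Up 0 om, column 1 Rp, column 2 Rp,
        column 3 Rp] :: complex ^ 5 ^ 5) = 0"
      by (rule det_zero_of_pairing[OF \<open>plus.phi2 \<noteq> 0\<close>])
    then show ?thesis by (simp only: lopatinski_det_def det_transpose)
  qed
  \<comment> \<open>Admissible bases exist, since the computed limit spaces have dimensions 1 and 3;
    hence the set of values is not empty.\<close>
  have "indexed_basis {..<1::nat} (\<lambda>i. minus.eigvec 0 om r) (vec.span {minus.eigvec 0 om r})"
    using r(1) by (auto simp: indexed_basis_def inj_on_def lessThan_Suc)
  from column_basis_of_indexed_basis[where 'k = 1, OF this card_num1]
  obtain Rm :: "complex ^ 1 ^ 5" where "column_basis Rm (vec.span {minus.eigvec 0 om r})" by blast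
  then have Rm: "minus_basis ?Um 0 om Rm"
    using r(2) freq unfolding minus_basis_def extended_basis_def by blast
  obtain b where "indexed_basis {..<3::nat} b K"
    using plus.kernel_basis[OF assms(5)] unfolding K_def by blast
  from column_basis_of_indexed_basis[where 'k = 3, OF this]
  obtain Rp :: "complex ^ 3 ^ 5" where "column_basis Rp K" by auto
  then have Rp: "plus_basis ?Up 0 om Rp"
    using unstable(1) freq unfolding plus_basis_def extended_basis_def by blast
  have "0 \<in> lopatinski_values ?Um ?Up 0 om"
    using zero[OF Rm Rp] Rm Rp unfolding lopatinski_values_def by fastforce
  moreover have "lopatinski_values ?Um ?Up 0 om \<subseteq> {0}"
    unfolding lopatinski_values_def using zero by blast
  ultimately show ?thesis by blast
qed

theorem theorem1:
  fixes a :: real and Um Up :: state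
  assumes "slow_parallel_shock a Um Up"
    and "rho Um = 1"
    and "rho Up = (a\<^sup>2 + 2) / (a\<^sup>2 + 1)"
  shows "lopatinski_values Um Up 0 1 = {0} \<and> lopatinski_values Um Up 0 (-1) = {0}"
proof -
  obtain m where m: "m > 0" "m\<^sup>2 > 1" "m\<^sup>2 < a\<^sup>2" "rho Up = m\<^sup>2"
    "Um = par_state 1 m a" "Up = par_state (m\<^sup>2) (1 / m) a"
    using slow_parallel_shock_states[OF assms(1,2)] .
  have "a\<^sup>2 + 1 \<noteq> 0" using zero_le_power2[of a] by linarith
  then have "m\<^sup>2 * (a\<^sup>2 + 1) = a\<^sup>2 + 2" using m(4) assms(3) by (simp add: field_simps)
  then show ?thesis
    unfolding m(5,6) using lopatinski_values_zero[OF m(1-3)] by simp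
qed

end
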